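(* Let $(M^n,g)$ be a Riemannian manifold carrying a conformal product structure with Lee form $\theta=\theta_1+\theta_2$ and orthogonal $D$-parallel splitting $TM=T_1\oplus T_2$, with $p=\operatorname{rank}T_1\ge2$, $q=\operatorname{rank}T_2\ge2$, $n=p+q$, and assume $\operatorname{Ric}(T_1,T_2)=0$. Let $F=d\theta$. Then $$d\theta_1=\frac{p-1}{n-2}F+\theta_1\wedge\theta_2,\qquad d\theta_2=\frac{q-1}{n-2}F-\theta_1\wedge\theta_2.$$
   Context: Let $\nabla$ be the Levi-Civita connection of $g$. A Weyl connection on $(M,g)$ is a connection of the form $D_XY=\nabla_XY+\theta(Y)X+\theta(X)Y-g(X,Y)\theta^\sharp$ for a one-form $\theta$, called its Lee form. A conformal product structure on $(M,g)$ is a $g$-orthogonal splitting $TM=T_1\oplus T_2$ into distributions of constant rank together with a Weyl connection $D$ (the adapted Weyl connection) preserving both $T_1$ and $T_2$. The components $\theta_i\in T_i^*$ are defined by $\theta=\theta_1+\theta_2$, with $\theta_1$ vanishing on $T_2$ and $\theta_2$ vanishing on $T_1$. Conventions: $d\theta(X,Y)=X\theta(Y)-Y\theta(X)-\theta([X,Y])$, $(\alpha\wedge\beta)(X,Y)=\alpha(X)\beta(Y)-\alpha(Y)\beta(X)$. *)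

theory Defs
  imports "HOL-Analysis.Analysis" "HOL-Library.Function_Algebras"
begin

section \<open>Smooth maps between normed spaces\<close>

text \<open>Both notions are meant for open \<open>S\<close>.\<close>

fun Ck_on :: "nat \<Rightarrow> ('a::real_normed_vector \<Rightarrow> 'b::real_normed_vector) \<Rightarrow> 'a set \<Rightarrow> bool" where
  "Ck_on 0 f S \<longleftrightarrow> continuous_on S f"
| "Ck_on (Suc k) f S \<longleftrightarrow>
     (\<forall>x\<in>S. f differentiable (at x)) \<and> (\<forall>v. Ck_on k (\<lambda>x. frechet_derivative f (at x) v) S)"

definition smooth_on :: "('a::real_normed_vector \<Rightarrow> 'b::real_normed_vector) \<Rightarrow> 'a set \<Rightarrow> bool" where
  "smooth_on f S \<longleftrightarrow> (\<forall>k. Ck_on k f S)"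


section \<open>Manifolds and smooth functions\<close>

text \<open>The manifold is the whole type \<open>'m\<close>, its dimension is \<open>DIM('e)\<close>. A chart is a pair of its
  domain and its coordinate map, whose values off the domain are irrelevant. The atlas is not
  required to be maximal.\<close>

type_synonym ('m, 'e) chart = "'m set \<times> ('m \<Rightarrow> 'e)"

definition smooth_atlas ::
    "('m::{t2_space, second_countable_topology}, 'e::euclidean_space) chart set \<Rightarrow> bool" where
  "smooth_atlas A \<longleftrightarrow>
     (\<Union>(U, \<phi>)\<in>A. U) = UNIV \<and>
     (\<forall>(U, \<phi>)\<in>A. open U \<and> open (\<phi> ` U) \<and> homeomorphism U (\<phi> ` U) \<phi> (inv_into U \<phi>)) \<and>
     (\<forall>(U, \<phi>)\<in>A. \<forall>(V, \<psi>)\<in>A. smooth_on (\<psi> \<circ> inv_into U \<phi>) (\<phi> ` (U \<inter> V)))"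

definition smooth_function_on ::
    "('m::topological_space, 'e::euclidean_space) chart set \<Rightarrow> 'm set \<Rightarrow> ('m \<Rightarrow> real) \<Rightarrow> bool" where
  "smooth_function_on A W f \<longleftrightarrow>
     open W \<and> (\<forall>(U, \<phi>)\<in>A. smooth_on (f \<circ> inv_into U \<phi>) (\<phi> ` (U \<inter> W)))"

definition smooth_near ::
    "('m::topological_space, 'e::euclidean_space) chart set \<Rightarrow> 'm \<Rightarrow> ('m \<Rightarrow> real) \<Rightarrow> bool" where
  "smooth_near A x f \<longleftrightarrow> (\<exists>W. x \<in> W \<and> smooth_function_on A W f)"


section \<open>Tangent vectors\<close>

text \<open>A tangent vector at \<open>x\<close> is a directional derivative at \<open>x\<close>, acting on functions that are
  smooth near \<open>x\<close>. It is set to 0 on all other functions, so that equality of tangent vectors is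
  equality of HOL functions. Vector space operations are the pointwise ones, which gives access to
  the library's \<^const>\<open>span\<close>, \<^const>\<open>dim\<close> etc.\<close>

instantiation "fun" :: (type, real_vector) real_vector
begin

definition scaleR_fun_def: "r *\<^sub>R f = (\<lambda>x. r *\<^sub>R f x)"

instance
  by standard (auto simp: scaleR_fun_def fun_eq_iff scaleR_add_right scaleR_add_left)

end

type_synonym 'm tvec = "('m \<Rightarrow> real) \<Rightarrow> real"

definition directional_derivative ::
    "('m::topological_space, 'e::euclidean_space) chart set \<Rightarrow> ('m, 'e) chart \<Rightarrow> 'm \<Rightarrow> 'e \<Rightarrow> 'm tvec" where
  "directional_derivative A c x w f =
     (case c of (U, \<phi>) \<Rightarrow>
        if smooth_near A x f then frechet_derivative (f \<circ> inv_into U \<phi>) (at (\<phi> x)) w else 0)"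

definition tangent_space ::
    "('m::topological_space, 'e::euclidean_space) chart set \<Rightarrow> 'm \<Rightarrow> 'm tvec set" where
  "tangent_space A x = {directional_derivative A (U, \<phi>) x w | U \<phi> w. (U, \<phi>) \<in> A \<and> x \<in> U}"


section \<open>Vector fields, one-forms, metrics\<close>

text \<open>Local objects on an open set \<open>W\<close> are total HOL functions whose values outside \<open>W\<close> are
  irrelevant.\<close>

type_synonym 'm vfield = "'m \<Rightarrow> 'm tvec"
type_synonym 'm form1 = "'m \<Rightarrow> 'm tvec \<Rightarrow> real"
type_synonym 'm metric = "'m \<Rightarrow> 'm tvec \<Rightarrow> 'm tvec \<Rightarrow> real"

definition vector_field_on ::
    "('m::topological_space, 'e::euclidean_space) chart set \<Rightarrow> 'm set \<Rightarrow> 'm vfield \<Rightarrow> bool" where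
  "vector_field_on A W X \<longleftrightarrow>
     open W \<and> (\<forall>x\<in>W. X x \<in> tangent_space A x) \<and>
     (\<forall>V f. V \<subseteq> W \<and> smooth_function_on A V f \<longrightarrow> smooth_function_on A V (\<lambda>x. X x f))"

definition lie_bracket ::
    "('m::topological_space, 'e::euclidean_space) chart set \<Rightarrow> 'm vfield \<Rightarrow> 'm vfield \<Rightarrow> 'm vfield" where
  "lie_bracket A X Y x f =
     (if smooth_near A x f then X x (\<lambda>y. Y y f) - Y x (\<lambda>y. X y f) else 0)"

definition covector ::
    "('m::topological_space, 'e::euclidean_space) chart set \<Rightarrow> 'm \<Rightarrow> ('m tvec \<Rightarrow> real) \<Rightarrow> bool" where
  "covector A x \<alpha> \<longleftrightarrow>
     (\<forall>v\<in>tangent_space A x. \<forall>w\<in>tangent_space A x. \<alpha> (v + w) = \<alpha> v + \<alpha> w) \<and>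
     (\<forall>r. \<forall>v\<in>tangent_space A x. \<alpha> (r *\<^sub>R v) = r * \<alpha> v)"

definition one_form ::
    "('m::topological_space, 'e::euclidean_space) chart set \<Rightarrow> 'm form1 \<Rightarrow> bool" where
  "one_form A \<theta> \<longleftrightarrow>
     (\<forall>x. covector A x (\<theta> x)) \<and>
     (\<forall>W X. vector_field_on A W X \<longrightarrow> smooth_function_on A W (\<lambda>x. \<theta> x (X x)))"

definition ext_deriv ::
    "('m::topological_space, 'e::euclidean_space) chart set \<Rightarrow> 'm form1 \<Rightarrow>
     'm vfield \<Rightarrow> 'm vfield \<Rightarrow> 'm \<Rightarrow> real" where
  "ext_deriv A \<theta> X Y x =
     X x (\<lambda>y. \<theta> y (Y y)) - Y x (\<lambda>y. \<theta> y (X y)) - \<theta> x (lie_bracket A X Y x)"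

definition wedge :: "'m form1 \<Rightarrow> 'm form1 \<Rightarrow> 'm vfield \<Rightarrow> 'm vfield \<Rightarrow> 'm \<Rightarrow> real" where
  "wedge \<alpha> \<beta> X Y x = \<alpha> x (X x) * \<beta> x (Y x) - \<alpha> x (Y x) * \<beta> x (X x)"

definition riemannian_metric ::
    "('m::topological_space, 'e::euclidean_space) chart set \<Rightarrow> 'm metric \<Rightarrow> bool" where
  "riemannian_metric A g \<longleftrightarrow>
     (\<forall>x. \<forall>v\<in>tangent_space A x. covector A x (g x v)) \<and>
     (\<forall>x. \<forall>v\<in>tangent_space A x. \<forall>w\<in>tangent_space A x. g x v w = g x w v) \<and>
     (\<forall>x. \<forall>v\<in>tangent_space A x. v \<noteq> 0 \<longrightarrow> g x v v > 0) \<and>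
     (\<forall>W X Y. vector_field_on A W X \<and> vector_field_on A W Y \<longrightarrow>
        smooth_function_on A W (\<lambda>x. g x (X x) (Y x)))"

definition sharp ::
    "('m::topological_space, 'e::euclidean_space) chart set \<Rightarrow> 'm metric \<Rightarrow> 'm form1 \<Rightarrow> 'm vfield" where
  "sharp A g \<theta> x =
     (THE v. v \<in> tangent_space A x \<and> (\<forall>w\<in>tangent_space A x. g x v w = \<theta> x w))"


section \<open>Connections and curvature\<close>

text \<open>A connection acts on pairs of vector fields over an arbitrary common open set. Global
  connections extend uniquely to such an operator, so nothing is lost; the second clause says that
  the operator commutes with restriction to smaller open sets.\<close>

type_synonym 'm conn = "'m vfield \<Rightarrow> 'm vfield \<Rightarrow> 'm vfield"

definition is_connection ::
    "('m::topological_space, 'e::euclidean_space) chart set \<Rightarrow> 'm conn \<Rightarrow> bool" where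
  "is_connection A D \<longleftrightarrow>
     (\<forall>W X Y. vector_field_on A W X \<and> vector_field_on A W Y \<longrightarrow> vector_field_on A W (D X Y)) \<and>
     (\<forall>W X X' Y Y'. vector_field_on A W X \<and> vector_field_on A W X' \<and>
        vector_field_on A W Y \<and> vector_field_on A W Y' \<and>
        (\<forall>x\<in>W. X x = X' x \<and> Y x = Y' x) \<longrightarrow> (\<forall>x\<in>W. D X Y x = D X' Y' x)) \<and>
     (\<forall>W X X' Y. vector_field_on A W X \<and> vector_field_on A W X' \<and> vector_field_on A W Y \<longrightarrow>
        (\<forall>x\<in>W. D (\<lambda>y. X y + X' y) Y x = D X Y x + D X' Y x)) \<and>
     (\<forall>W X Y Y'. vector_field_on A W X \<and> vector_field_on A W Y \<and> vector_field_on A W Y' \<longrightarrow>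
        (\<forall>x\<in>W. D X (\<lambda>y. Y y + Y' y) x = D X Y x + D X Y' x)) \<and>
     (\<forall>W f X Y. smooth_function_on A W f \<and> vector_field_on A W X \<and> vector_field_on A W Y \<longrightarrow>
        (\<forall>x\<in>W. D (\<lambda>y. f y *\<^sub>R X y) Y x = f x *\<^sub>R D X Y x \<and>
               D X (\<lambda>y. f y *\<^sub>R Y y) x = X x f *\<^sub>R Y x + f x *\<^sub>R D X Y x))"

definition levi_civita ::
    "('m::topological_space, 'e::euclidean_space) chart set \<Rightarrow> 'm metric \<Rightarrow> 'm conn \<Rightarrow> bool" where
  "levi_civita A g nab \<longleftrightarrow>
     is_connection A nab \<and>
     (\<forall>W X Y. vector_field_on A W X \<and> vector_field_on A W Y \<longrightarrow>
        (\<forall>x\<in>W. nab X Y x - nab Y X x = lie_bracket A X Y x)) \<and>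
     (\<forall>W X Y Z. vector_field_on A W X \<and> vector_field_on A W Y \<and> vector_field_on A W Z \<longrightarrow>
        (\<forall>x\<in>W. X x (\<lambda>y. g y (Y y) (Z y)) = g x (nab X Y x) (Z x) + g x (Y x) (nab X Z x)))"

definition curvature ::
    "('m::topological_space, 'e::euclidean_space) chart set \<Rightarrow> 'm conn \<Rightarrow>
     'm vfield \<Rightarrow> 'm vfield \<Rightarrow> 'm vfield \<Rightarrow> 'm vfield" where
  "curvature A D X Y Z x =
     D X (D Y Z) x - D Y (D X Z) x - D (lie_bracket A X Y) Z x"

text \<open>The value of the curvature tensor on tangent vectors, through arbitrary local extensions of
  these to vector fields.\<close>

definition curvature_at ::
    "('m::topological_space, 'e::euclidean_space) chart set \<Rightarrow> 'm conn \<Rightarrow> 'm \<Rightarrow>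
     'm tvec \<Rightarrow> 'm tvec \<Rightarrow> 'm tvec \<Rightarrow> 'm tvec" where
  "curvature_at A D x u v w =
     (THE r. \<forall>W X Y Z. x \<in> W \<and> vector_field_on A W X \<and> vector_field_on A W Y \<and>
        vector_field_on A W Z \<and> X x = u \<and> Y x = v \<and> Z x = w \<longrightarrow> curvature A D X Y Z x = r)"

definition trace_on :: "'v::real_vector set \<Rightarrow> ('v \<Rightarrow> 'v) \<Rightarrow> real" where
  "trace_on V L =
     (let B = (SOME B. independent B \<and> span B = V) in \<Sum>b\<in>B. representation B (L b) b)"

definition ricci ::
    "('m::topological_space, 'e::euclidean_space) chart set \<Rightarrow> 'm conn \<Rightarrow> 'm \<Rightarrow>
     'm tvec \<Rightarrow> 'm tvec \<Rightarrow> real" where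
  "ricci A nab x v w = trace_on (tangent_space A x) (\<lambda>u. curvature_at A nab x u v w)"


section \<open>Conformal product structures\<close>

definition weyl_connection ::
    "('m::topological_space, 'e::euclidean_space) chart set \<Rightarrow> 'm metric \<Rightarrow> 'm conn \<Rightarrow>
     'm form1 \<Rightarrow> 'm conn \<Rightarrow> bool" where
  "weyl_connection A g nab \<theta> D \<longleftrightarrow>
     one_form A \<theta> \<and> is_connection A D \<and>
     (\<forall>W X Y. vector_field_on A W X \<and> vector_field_on A W Y \<longrightarrow>
        (\<forall>x\<in>W. D X Y x = nab X Y x + \<theta> x (Y x) *\<^sub>R X x + \<theta> x (X x) *\<^sub>R Y x
                          - g x (X x) (Y x) *\<^sub>R sharp A g \<theta> x))"

definition distribution ::
    "('m::topological_space, 'e::euclidean_space) chart set \<Rightarrow> nat \<Rightarrow> ('m \<Rightarrow> 'm tvec set) \<Rightarrow> bool" where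
  "distribution A r T \<longleftrightarrow>
     (\<forall>x. subspace (T x) \<and> T x \<subseteq> tangent_space A x \<and> dim (T x) = r) \<and>
     (\<forall>x. \<exists>W E. open W \<and> x \<in> W \<and> (\<forall>i<r. vector_field_on A W (E i)) \<and>
        (\<forall>y\<in>W. T y = span ((\<lambda>i. E i y) ` {..<r})))"

definition orthogonal_splitting ::
    "('m::topological_space, 'e::euclidean_space) chart set \<Rightarrow> 'm metric \<Rightarrow>
     ('m \<Rightarrow> 'm tvec set) \<Rightarrow> ('m \<Rightarrow> 'm tvec set) \<Rightarrow> bool" where
  "orthogonal_splitting A g T1 T2 \<longleftrightarrow>
     (\<forall>x. tangent_space A x = {v + w | v w. v \<in> T1 x \<and> w \<in> T2 x} \<and> T1 x \<inter> T2 x = {0} \<and>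
          (\<forall>v\<in>T1 x. \<forall>w\<in>T2 x. g x v w = 0))"

definition preserves ::
    "('m::topological_space, 'e::euclidean_space) chart set \<Rightarrow> 'm conn \<Rightarrow> ('m \<Rightarrow> 'm tvec set) \<Rightarrow> bool" where
  "preserves A D T \<longleftrightarrow>
     (\<forall>W X Y. vector_field_on A W X \<and> vector_field_on A W Y \<and> (\<forall>x\<in>W. Y x \<in> T x) \<longrightarrow>
        (\<forall>x\<in>W. D X Y x \<in> T x))"

text \<open>\<open>nab\<close> is the Levi-Civita connection of \<open>g\<close>, \<open>p\<close> and \<open>q\<close> are the ranks of \<open>T1\<close> and \<open>T2\<close>, and
  \<open>\<theta>\<close> is the Lee form of the adapted Weyl connection \<open>D\<close>.\<close>

definition conformal_product_structure ::
    "('m::topological_space, 'e::euclidean_space) chart set \<Rightarrow> 'm metric \<Rightarrow> 'm conn \<Rightarrow>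
     nat \<Rightarrow> nat \<Rightarrow> ('m \<Rightarrow> 'm tvec set) \<Rightarrow> ('m \<Rightarrow> 'm tvec set) \<Rightarrow> 'm form1 \<Rightarrow> 'm conn \<Rightarrow> bool" where
  "conformal_product_structure A g nab p q T1 T2 \<theta> D \<longleftrightarrow>
     distribution A p T1 \<and> distribution A q T2 \<and> orthogonal_splitting A g T1 T2 \<and>
     weyl_connection A g nab \<theta> D \<and> preserves A D T1 \<and> preserves A D T2"

text \<open>\<open>\<theta> = \<theta>1 + \<theta>2\<close> with \<open>\<theta>1\<close> vanishing on \<open>T2\<close> and \<open>\<theta>2\<close> vanishing on \<open>T1\<close>. Smoothness of \<open>\<theta>1\<close>
  and \<open>\<theta>2\<close> is a consequence and not required.\<close>

definition form_components ::
    "('m::topological_space, 'e::euclidean_space) chart set \<Rightarrow>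
     ('m \<Rightarrow> 'm tvec set) \<Rightarrow> ('m \<Rightarrow> 'm tvec set) \<Rightarrow> 'm form1 \<Rightarrow> 'm form1 \<Rightarrow> 'm form1 \<Rightarrow> bool" where
  "form_components A T1 T2 \<theta> \<theta>1 \<theta>2 \<longleftrightarrow>
     (\<forall>x. covector A x (\<theta>1 x) \<and> covector A x (\<theta>2 x) \<and>
          (\<forall>v\<in>tangent_space A x. \<theta> x v = \<theta>1 x v + \<theta>2 x v) \<and>
          (\<forall>v\<in>T2 x. \<theta>1 x v = 0) \<and> (\<forall>v\<in>T1 x. \<theta>2 x v = 0))"

end

theory Submission
  imports Defs
begin

text \<open>
  Write \<open>F = d\<theta>\<close> and \<open>h(X, Y) = (D\<^sub>X \<theta>)(Y) + \<theta>(X) \<theta>(Y)\<close>, the \<open>curvature_defect\<close> below. For \<open>X\<close>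
  in \<open>T1\<close> and \<open>Y\<close> in \<open>T2\<close>, the hypothesis on the Ricci tensor is a linear relation between \<open>h(X, Y)\<close>
  and \<open>h(Y, X)\<close>. Since \<open>D\<close> has no torsion, \<open>h(X, Y) - h(Y, X) = F(X, Y)\<close> is a second one, and the two
  determine \<open>h(X, Y)\<close> (lemma \<open>form_derivative_mixed\<close>).

  The first relation comes from comparing the curvatures of \<open>\<nabla>\<close> and \<open>D\<close>. For \<open>E\<close>, \<open>X\<close> in \<open>T1\<close> and \<open>Y\<close>
  in \<open>T2\<close> the connections are only applied to orthogonal pairs, where the \<open>\<theta>\<^sup>\<sharp>\<close> term of the Weyl
  connection drops out, and (lemma \<open>curvature_orthogonal\<close>)
  \<open>R\<^sup>\<nabla>(E, X)Y = R\<^sup>D(E, X)Y + h(X, Y)E - h(E, Y)X - F(E, X)Y\<close>.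
  As \<open>R\<^sup>D(E, X)Y\<close> lies in \<open>T2\<close>, summing the \<open>E\<close>-components over an orthogonal frame of \<open>T1\<close> leaves
  \<open>(p - 1) h(X, Y)\<close> (lemma \<open>curvature_trace_T1\<close>). For \<open>E\<close> in \<open>T2\<close> the first Bianchi identity and the
  skew symmetry of \<open>R\<^sup>\<nabla>\<close> give \<open>g(R\<^sup>\<nabla>(E, X)Y, E) = g(R\<^sup>\<nabla>(E, Y)X, E)\<close>, so the same computation with the
  two factors exchanged yields \<open>(q - 1) h(Y, X)\<close>. Therefore
  \<open>Ric(X, Y) = (p - 1) h(X, Y) + (q - 1) h(Y, X)\<close>.

  On two arguments from the same factor \<open>F\<close> vanishes (lemma \<open>lee_ext_deriv_zero_T2\<close>): for \<open>X\<close>, \<open>Y\<close> in \<open>T2\<close>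
  and \<open>V\<close> in \<open>T1\<close> the Bianchi identity of \<open>D\<close> puts \<open>R\<^sup>D(X, Y)V\<close> into \<open>T2\<close>, so that it is orthogonal to \<open>V\<close>,
  whereas \<open>D g = - 2 \<theta> \<otimes> g\<close> implies \<open>g(R\<^sup>D(X, Y)V, V) = F(X, Y) g(V, V)\<close>.

  Finally, with \<open>X = X1 + X2\<close> and \<open>Y = Y1 + Y2\<close> the decompositions along \<open>T1\<close> and \<open>T2\<close>,
  \<open>d\<theta>2(X, Y) = (D\<^sub>X \<theta>)(Y2) - (D\<^sub>Y \<theta>)(X2)\<close> because \<open>D\<close> preserves both factors, and
  \<open>d\<theta>1 = F - d\<theta>2\<close> (lemma \<open>ext_deriv_component\<close>). Substituting \<open>h\<close> gives both formulas.

  The Ricci tensor is defined through a curvature tensor at a point and a trace over an unspecified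
  basis. Both are made computable by local orthogonal frames, which Gram-Schmidt produces from the
  spanning fields of \<open>T1\<close> and \<open>T2\<close>: a vector field has smooth coordinates in such a frame, hence
  operators that are linear over smooth functions only see the value at the point
  (lemma \<open>tensorial_expansion\<close>), and the trace is the sum of the diagonal coordinates
  (lemma \<open>trace_on_eq_sum_coordinates\<close>).
\<close>

section \<open>Differentiability classes\<close>

text \<open>The derivatives in \<^const>\<open>Ck_on\<close> are two-sided ones of total functions. They are determined by
  the values on \<open>S\<close> because \<open>S\<close> is open.\<close>

lemma Ck_on_cong:
  assumes "open S" "\<And>x. x \<in> S \<Longrightarrow> f x = h x" "Ck_on k f S"
  shows "Ck_on k h S"
  using assms(2,3)
proof (induction k arbitrary: f h)
  case 0
  have "continuous_on S f \<longleftrightarrow> continuous_on S h"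
    by (rule continuous_on_cong) (simp_all add: 0)
  with 0 show ?case by simp
next
  case (Suc k)
  have "(f has_derivative frechet_derivative f (at x)) (at x)" if "x \<in> S" for x
    using Suc.prems(2) that by (simp add: frechet_derivative_works)
  then have d: "(h has_derivative frechet_derivative f (at x)) (at x)" if "x \<in> S" for x
    by (rule has_derivative_transform_within_open[OF _ assms(1)]) (use that Suc.prems(1) in simp_all)
  have "Ck_on k (\<lambda>x. frechet_derivative h (at x) v) S" for v
  proof (rule Suc.IH)
    show "Ck_on k (\<lambda>x. frechet_derivative f (at x) v) S" using Suc.prems(2) by simp
  qed (simp add: frechet_derivative_at[OF d])
  moreover have "\<forall>x\<in>S. h differentiable (at x)" using d differentiableI by blast
  ultimately show ?case by simp
qed

lemma Ck_on_subset: "Ck_on k f S \<Longrightarrow> T \<subseteq> S \<Longrightarrow> Ck_on k f T"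
  by (induction k arbitrary: f) (auto intro: continuous_on_subset)

lemma Ck_on_SucD: "Ck_on (Suc k) f S \<Longrightarrow> Ck_on k f S"
proof (induction k arbitrary: f)
  case 0
  then show ?case
    by (auto intro!: continuous_at_imp_continuous_on differentiable_imp_continuous_within)
next
  case (Suc k)
  have "Ck_on k (\<lambda>x. frechet_derivative f (at x) v) S" for v
    by (rule Suc.IH) (use Suc.prems in \<open>simp only: Ck_on.simps(2)[of "Suc k"]\<close>)
  moreover have "\<forall>x\<in>S. f differentiable (at x)"
    using Suc.prems unfolding Ck_on.simps(2)[of "Suc k"] by blast
  ultimately show ?case by simp
qed

lemma Ck_on_const: "Ck_on k (\<lambda>x. c) S"
  by (induction k arbitrary: c) auto

lemma Ck_on_add:
  assumes "open S" "Ck_on k f S" "Ck_on k h S"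
  shows "Ck_on k (\<lambda>x. f x + h x) S"
  using assms(2,3)
proof (induction k arbitrary: f h)
  case 0
  then show ?case by (auto intro: continuous_on_add)
next
  case (Suc k)
  have d: "((\<lambda>x. f x + h x) has_derivative
      (\<lambda>v. frechet_derivative f (at x) v + frechet_derivative h (at x) v)) (at x)" if "x \<in> S" for x
    using Suc.prems that by (intro has_derivative_add) (auto simp: frechet_derivative_works[symmetric])
  have "Ck_on k (\<lambda>x. frechet_derivative (\<lambda>x. f x + h x) (at x) v) S" for v
  proof (rule Ck_on_cong[OF assms(1)])
    show "Ck_on k (\<lambda>x. frechet_derivative f (at x) v + frechet_derivative h (at x) v) S"
      using Suc.prems by (intro Suc.IH) auto
  qed (simp add: frechet_derivative_at[OF d, symmetric])
  moreover have "\<forall>x\<in>S. (\<lambda>x. f x + h x) differentiable (at x)" using d differentiableI by blast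
  ultimately show ?case by simp
qed

text \<open>Each differentiation leaves one factor of every summand undifferentiated, so the induction has to
  weaken \<open>Suc k\<close> to \<open>k\<close> for it.\<close>

lemma Ck_on_mult:
  fixes f h :: "'a::real_normed_vector \<Rightarrow> real"
  assumes "open S" "Ck_on k f S" "Ck_on k h S"
  shows "Ck_on k (\<lambda>x. f x * h x) S"
  using assms(2,3)
proof (induction k arbitrary: f h)
  case 0
  then show ?case by (auto intro: continuous_on_mult)
next
  case (Suc k)
  have d: "((\<lambda>x. f x * h x) has_derivative
      (\<lambda>v. f x * frechet_derivative h (at x) v + frechet_derivative f (at x) v * h x)) (at x)"
    if "x \<in> S" for x
    using Suc.prems that by (intro has_derivative_mult) (auto simp: frechet_derivative_works[symmetric])
  have "Ck_on k (\<lambda>x. frechet_derivative (\<lambda>x. f x * h x) (at x) v) S" for v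
  proof (rule Ck_on_cong[OF assms(1)])
    show "Ck_on k (\<lambda>x. f x * frechet_derivative h (at x) v + frechet_derivative f (at x) v * h x) S"
      using Suc.prems Ck_on_SucD[of k f S] Ck_on_SucD[of k h S]
      by (intro Ck_on_add assms(1) Suc.IH) auto
  qed (simp add: frechet_derivative_at[OF d, symmetric])
  moreover have "\<forall>x\<in>S. (\<lambda>x. f x * h x) differentiable (at x)" using d differentiableI by blast
  ultimately show ?case by simp
qed

lemma Ck_on_inverse:
  fixes f :: "'a::real_normed_vector \<Rightarrow> real"
  assumes "open S" "\<And>x. x \<in> S \<Longrightarrow> f x \<noteq> 0" "Ck_on k f S"
  shows "Ck_on k (\<lambda>x. inverse (f x)) S"
  using assms(3)
proof (induction k)
  case 0
  then show ?case using assms(2) by (auto intro: continuous_on_inverse)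
next
  case (Suc k)
  have d: "((\<lambda>x. inverse (f x)) has_derivative
      (\<lambda>v. - (inverse (f x) * frechet_derivative f (at x) v * inverse (f x)))) (at x)"
    if "x \<in> S" for x
    using Suc.prems that assms(2)
    by (intro Deriv.has_derivative_inverse) (auto simp: frechet_derivative_works[symmetric])
  have "Ck_on k (\<lambda>x. frechet_derivative (\<lambda>x. inverse (f x)) (at x) v) S" for v
  proof (rule Ck_on_cong[OF assms(1)])
    show "Ck_on k (\<lambda>x. (- 1) * (inverse (f x) * frechet_derivative f (at x) v * inverse (f x))) S"
      using Suc.prems Ck_on_SucD[of k f S]
      by (intro Ck_on_mult assms(1) Suc.IH Ck_on_const) auto
  qed (simp add: frechet_derivative_at[OF d, symmetric])
  moreover have "\<forall>x\<in>S. (\<lambda>x. inverse (f x)) differentiable (at x)" using d differentiableI by blast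
  ultimately show ?case by simp
qed

section \<open>Smooth functions on a manifold\<close>

locale smooth_manifold =
  fixes A :: "('m::{t2_space, second_countable_topology}, 'e::euclidean_space) chart set"
  assumes atlas: "smooth_atlas A"
begin

lemma chart_cover: obtains U \<phi> where "(U, \<phi>) \<in> A" "x \<in> U"
proof -
  have "(\<Union>(U, \<phi>)\<in>A. U) = UNIV"
    using atlas unfolding smooth_atlas_def by (elim conjE)
  then have "x \<in> (\<Union>(U, \<phi>)\<in>A. U)" by simp
  then show ?thesis using that by blast
qed

context
  fixes U \<phi> assumes chart: "(U, \<phi>) \<in> A"
begin

lemma chart_open: "open U"
  and chart_homeo: "homeomorphism U (\<phi> ` U) \<phi> (inv_into U \<phi>)"
  and chart_image_open: "open (\<phi> ` U)"
proof -
  have "\<forall>(U, \<phi>)\<in>A. open U \<and> open (\<phi> ` U) \<and> homeomorphism U (\<phi> ` U) \<phi> (inv_into U \<phi>)"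
    using atlas unfolding smooth_atlas_def by (elim conjE)
  from bspec[OF this chart]
  show "open U" "homeomorphism U (\<phi> ` U) \<phi> (inv_into U \<phi>)" "open (\<phi> ` U)" by simp_all
qed

lemma inv_chart: "x \<in> U \<Longrightarrow> inv_into U \<phi> (\<phi> x) = x"
  using chart_homeo by (auto simp: homeomorphism_def)

lemma chart_image_open_Int: "open W \<Longrightarrow> open (\<phi> ` (U \<inter> W))"
  using homeomorphism_imp_open_map[OF chart_homeo, of "U \<inter> W"] chart_image_open
    openin_open_trans openin_open_Int by blast

lemma smooth_at_chart:
  assumes "smooth_near A x f" "x \<in> U"
  shows "(f \<circ> inv_into U \<phi>) differentiable (at (\<phi> x))"
proof -
  obtain W where "x \<in> W" "smooth_function_on A W f"
    using assms by (auto simp: smooth_near_def)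
  then have "Ck_on (Suc 0) (f \<circ> inv_into U \<phi>) (\<phi> ` (U \<inter> W))" "\<phi> x \<in> \<phi> ` (U \<inter> W)"
    using chart assms unfolding smooth_function_on_def smooth_on_def by blast+
  then show ?thesis by auto
qed

end

lemma smooth_function_on_open: "smooth_function_on A W f \<Longrightarrow> open W"
  by (simp add: smooth_function_on_def)

lemma smooth_function_onI:
  assumes "open W"
    "\<And>U \<phi> k. (U, \<phi>) \<in> A \<Longrightarrow> open (\<phi> ` (U \<inter> W)) \<Longrightarrow> Ck_on k (f \<circ> inv_into U \<phi>) (\<phi> ` (U \<inter> W))"
  shows "smooth_function_on A W f"
  using assms chart_image_open_Int unfolding smooth_function_on_def smooth_on_def by auto

lemma smooth_function_onD:
  assumes "smooth_function_on A W f" "(U, \<phi>) \<in> A"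
  shows "Ck_on k (f \<circ> inv_into U \<phi>) (\<phi> ` (U \<inter> W))"
  using assms unfolding smooth_function_on_def smooth_on_def by auto

lemma smooth_function_on_subset:
  assumes "smooth_function_on A W f" "open V" "V \<subseteq> W"
  shows "smooth_function_on A V f"
  by (rule smooth_function_onI[OF assms(2)], rule Ck_on_subset, rule smooth_function_onD[OF assms(1)])
    (use assms in auto)

lemma smooth_function_on_cong:
  assumes "smooth_function_on A W f" "\<And>x. x \<in> W \<Longrightarrow> f x = h x"
  shows "smooth_function_on A W h"
proof (rule smooth_function_onI)
  fix U \<phi> k assume *: "(U, \<phi>) \<in> A" "open (\<phi> ` (U \<inter> W))"
  show "Ck_on k (h \<circ> inv_into U \<phi>) (\<phi> ` (U \<inter> W))"
    by (rule Ck_on_cong[OF *(2) _ smooth_function_onD[OF assms(1) *(1)]])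
      (use inv_chart[OF *(1)] assms(2) in auto)
qed (rule smooth_function_on_open[OF assms(1)])

lemma smooth_function_on_const: "open W \<Longrightarrow> smooth_function_on A W (\<lambda>x. c)"
  by (rule smooth_function_onI) (auto simp: o_def Ck_on_const)

lemma smooth_function_on_add:
  assumes "smooth_function_on A W f" "smooth_function_on A W h"
  shows "smooth_function_on A W (\<lambda>x. f x + h x)"
proof (rule smooth_function_onI[OF smooth_function_on_open[OF assms(1)]])
  fix U \<phi> k assume *: "(U, \<phi>) \<in> A" "open (\<phi> ` (U \<inter> W))"
  show "Ck_on k ((\<lambda>x. f x + h x) \<circ> inv_into U \<phi>) (\<phi> ` (U \<inter> W))"
    using Ck_on_add[OF *(2) smooth_function_onD[OF assms(1) *(1)] smooth_function_onD[OF assms(2) *(1)]]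
    by (simp add: o_def)
qed

lemma smooth_function_on_mult:
  assumes "smooth_function_on A W f" "smooth_function_on A W h"
  shows "smooth_function_on A W (\<lambda>x. f x * h x)"
proof (rule smooth_function_onI[OF smooth_function_on_open[OF assms(1)]])
  fix U \<phi> k assume *: "(U, \<phi>) \<in> A" "open (\<phi> ` (U \<inter> W))"
  show "Ck_on k ((\<lambda>x. f x * h x) \<circ> inv_into U \<phi>) (\<phi> ` (U \<inter> W))"
    using Ck_on_mult[OF *(2) smooth_function_onD[OF assms(1) *(1)] smooth_function_onD[OF assms(2) *(1)]]
    by (simp add: o_def)
qed

lemma smooth_function_on_minus:
  assumes "smooth_function_on A W f"
  shows "smooth_function_on A W (\<lambda>x. - f x)"
  using smooth_function_on_mult[OF smooth_function_on_const[OF smooth_function_on_open[OF assms], of "-1"] assms]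
  by simp

lemma smooth_function_on_divide:
  assumes "smooth_function_on A W f" "smooth_function_on A W h" "\<And>x. x \<in> W \<Longrightarrow> h x \<noteq> 0"
  shows "smooth_function_on A W (\<lambda>x. f x / h x)"
proof -
  have "smooth_function_on A W (\<lambda>x. inverse (h x))"
    using smooth_function_on_open[OF assms(1)]
  proof (rule smooth_function_onI)
    fix U \<phi> k assume *: "(U, \<phi>) \<in> A" "open (\<phi> ` (U \<inter> W))"
    have "(h \<circ> inv_into U \<phi>) y \<noteq> 0" if "y \<in> \<phi> ` (U \<inter> W)" for y
      using that assms(3) by (auto simp: inv_chart[OF *(1)])
    from Ck_on_inverse[OF *(2) this smooth_function_onD[OF assms(2) *(1)]]
    show "Ck_on k ((\<lambda>x. inverse (h x)) \<circ> inv_into U \<phi>) (\<phi> ` (U \<inter> W))"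
      by (simp add: o_def)
  qed
  from smooth_function_on_mult[OF assms(1) this] show ?thesis by (simp add: field_simps)
qed

lemma smooth_function_nonzero_near:
  assumes "smooth_function_on A W f" "x \<in> W" "f x \<noteq> 0"
  obtains V where "open V" "x \<in> V" "V \<subseteq> W" "\<And>y. y \<in> V \<Longrightarrow> f y \<noteq> 0"
proof -
  obtain U \<phi> where c: "(U, \<phi>) \<in> A" "x \<in> U" by (rule chart_cover)
  have W: "open W" using assms(1) by (rule smooth_function_on_open)
  have "continuous_on (\<phi> ` (U \<inter> W)) (f \<circ> inv_into U \<phi>)"
    using smooth_function_onD[OF assms(1) c(1), of 0] by simp
  moreover have "continuous_on (U \<inter> W) \<phi>"
    using chart_homeo[OF c(1)] continuous_on_subset by (fastforce simp: homeomorphism_def)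
  ultimately have "continuous_on (U \<inter> W) ((f \<circ> inv_into U \<phi>) \<circ> \<phi>)"
    by (rule continuous_on_compose[rotated])
  then have "continuous_on (U \<inter> W) f"
    by (rule continuous_on_cong[THEN iffD1, OF refl, rotated]) (auto simp: inv_chart[OF c(1)])
  then have "open ((U \<inter> W) \<inter> f -` (- {0}))"
    using chart_open[OF c(1)] W by (intro continuous_open_preimage) auto
  then show ?thesis using that[of "(U \<inter> W) \<inter> f -` (- {0})"] c assms by auto
qed

lemma smooth_near_I: "smooth_function_on A W f \<Longrightarrow> x \<in> W \<Longrightarrow> smooth_near A x f"
  by (auto simp: smooth_near_def)

lemma smooth_near_cong:
  assumes "open W" "x \<in> W" "\<And>y. y \<in> W \<Longrightarrow> f y = h y" "smooth_near A x f"
  shows "smooth_near A x h"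
proof -
  obtain V where V: "x \<in> V" "smooth_function_on A V f"
    using assms(4) by (auto simp: smooth_near_def)
  have "smooth_function_on A (V \<inter> W) h"
    by (rule smooth_function_on_cong[OF smooth_function_on_subset[OF V(2)]])
      (use assms smooth_function_on_open[OF V(2)] in auto)
  with V assms show ?thesis by (auto simp: smooth_near_def)
qed

lemma smooth_near_arith:
  assumes "smooth_near A x f" "smooth_near A x h"
  shows "smooth_near A x (\<lambda>y. f y + h y)" "smooth_near A x (\<lambda>y. f y * h y)"
proof -
  obtain V W where V: "x \<in> V" "smooth_function_on A V f" and W: "x \<in> W" "smooth_function_on A W h"
    using assms by (auto simp: smooth_near_def)
  have "open (V \<inter> W)"
    using V W smooth_function_on_open by blast
  then have f: "smooth_function_on A (V \<inter> W) f" and h: "smooth_function_on A (V \<inter> W) h"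
    using smooth_function_on_subset[OF V(2)] smooth_function_on_subset[OF W(2)] by simp_all
  have x: "x \<in> V \<inter> W" using V W by simp
  show "smooth_near A x (\<lambda>y. f y + h y)" "smooth_near A x (\<lambda>y. f y * h y)"
    by (rule smooth_near_I[OF smooth_function_on_add[OF f h] x],
        rule smooth_near_I[OF smooth_function_on_mult[OF f h] x])
qed

section \<open>Tangent vectors and covectors\<close>

text \<open>By the chain rule, the derivative of the transition map carries the direction \<open>w\<close> from one chart
  to the other. It follows that a single chart at \<open>x\<close> already produces all tangent vectors at \<open>x\<close>, so
  that they form a vector space.\<close>

lemma directional_derivative_change_chart:
  assumes "(U, \<phi>) \<in> A" "x \<in> U" "(V, \<psi>) \<in> A" "x \<in> V"
  shows "directional_derivative A (V, \<psi>) x w =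
    directional_derivative A (U, \<phi>) x (frechet_derivative (\<phi> \<circ> inv_into V \<psi>) (at (\<psi> x)) w)"
proof
  fix f
  let ?t = "\<phi> \<circ> inv_into V \<psi>"
  show "directional_derivative A (V, \<psi>) x w f =
    directional_derivative A (U, \<phi>) x (frechet_derivative ?t (at (\<psi> x)) w) f"
  proof (cases "smooth_near A x f")
    case True
    have o: "open (\<psi> ` (V \<inter> U))"
      using chart_image_open_Int[OF assms(3)] chart_open[OF assms(1)] by auto
    have "smooth_on ?t (\<psi> ` (V \<inter> U))"
      using atlas assms unfolding smooth_atlas_def by blast
    then have "Ck_on (Suc 0) ?t (\<psi> ` (V \<inter> U))" by (simp add: smooth_on_def)
    then have 1: "?t differentiable (at (\<psi> x))" using assms by auto
    have tx: "?t (\<psi> x) = \<phi> x" using inv_chart[OF assms(3,4)] by simp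
    have 2: "(f \<circ> inv_into U \<phi>) differentiable (at (?t (\<psi> x)))"
      unfolding tx by (rule smooth_at_chart[OF assms(1) True assms(2)])
    have "((f \<circ> inv_into U \<phi>) \<circ> ?t has_derivative
        (frechet_derivative (f \<circ> inv_into U \<phi>) (at (\<phi> x)) \<circ> frechet_derivative ?t (at (\<psi> x)))) (at (\<psi> x))"
      using 1 2 diff_chain_at frechet_derivative_works tx by metis
    then have "(f \<circ> inv_into V \<psi> has_derivative
        (frechet_derivative (f \<circ> inv_into U \<phi>) (at (\<phi> x)) \<circ> frechet_derivative ?t (at (\<psi> x)))) (at (\<psi> x))"
      by (rule has_derivative_transform_within_open[OF _ o])
        (use assms in \<open>auto simp: inv_chart\<close>)
    from fun_cong[OF frechet_derivative_at[OF this], of w] True show ?thesis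
      by (simp add: directional_derivative_def)
  qed (simp add: directional_derivative_def)
qed

lemma tangent_space_eq_range:
  assumes "(U, \<phi>) \<in> A" "x \<in> U"
  shows "tangent_space A x = range (directional_derivative A (U, \<phi>) x)"
proof (rule set_eqI, rule iffI)
  fix v assume "v \<in> tangent_space A x"
  then obtain V \<psi> w where "(V, \<psi>) \<in> A" "x \<in> V" "v = directional_derivative A (V, \<psi>) x w"
    unfolding tangent_space_def mem_Collect_eq by (elim exE conjE)
  with directional_derivative_change_chart[OF assms, of V \<psi> w]
  show "v \<in> range (directional_derivative A (U, \<phi>) x)" by simp
next
  fix v assume "v \<in> range (directional_derivative A (U, \<phi>) x)"
  then obtain w where "v = directional_derivative A (U, \<phi>) x w" by (rule rangeE)
  with assms show "v \<in> tangent_space A x" unfolding tangent_space_def mem_Collect_eq by blast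
qed

lemma linear_directional_derivative:
  assumes "(U, \<phi>) \<in> A" "x \<in> U"
  shows "linear (directional_derivative A (U, \<phi>) x)"
proof -
  have *: "linear (frechet_derivative (f \<circ> inv_into U \<phi>) (at (\<phi> x)))" if "smooth_near A x f" for f
    by (rule linear_frechet_derivative) (rule smooth_at_chart[OF assms(1) that assms(2)])
  show ?thesis
  proof (rule linearI; rule ext)
    fix a b :: 'e and r :: real and f
    show "directional_derivative A (U, \<phi>) x (a + b) f =
        (directional_derivative A (U, \<phi>) x a + directional_derivative A (U, \<phi>) x b) f"
      by (cases "smooth_near A x f") (simp_all add: directional_derivative_def linear_add[OF *])
    show "directional_derivative A (U, \<phi>) x (r *\<^sub>R a) f =
        (r *\<^sub>R directional_derivative A (U, \<phi>) x a) f"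
      by (cases "smooth_near A x f")
        (simp_all add: directional_derivative_def scaleR_fun_def linear_scale[OF *])
  qed
qed

lemma subspace_tangent_space: "subspace (tangent_space A x)"
proof -
  obtain U \<phi> where c: "(U, \<phi>) \<in> A" "x \<in> U" by (rule chart_cover)
  show ?thesis unfolding tangent_space_eq_range[OF c]
    using linear_subspace_image[OF linear_directional_derivative[OF c] subspace_UNIV] .
qed

context
  fixes v x assumes v: "v \<in> tangent_space A x"
begin

lemma tangent_rep:
  obtains U \<phi> w where "(U, \<phi>) \<in> A" "x \<in> U" "v = directional_derivative A (U, \<phi>) x w"
proof -
  from v have "\<exists>U \<phi> w. v = directional_derivative A (U, \<phi>) x w \<and> (U, \<phi>) \<in> A \<and> x \<in> U"
    by (simp add: tangent_space_def)
  then show ?thesis using that by blast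
qed

lemma tangent_not_smooth: "\<not> smooth_near A x f \<Longrightarrow> v f = 0"
proof -
  assume "\<not> smooth_near A x f"
  moreover obtain U \<phi> w where "v = directional_derivative A (U, \<phi>) x w" by (rule tangent_rep)
  ultimately show ?thesis by (simp add: directional_derivative_def)
qed

lemma tangent_const: "v (\<lambda>y. c) = 0"
proof -
  obtain U \<phi> w where "v = directional_derivative A (U, \<phi>) x w" by (rule tangent_rep)
  then show ?thesis by (simp add: directional_derivative_def o_def)
qed

lemma tangent_cong:
  assumes "open W" "x \<in> W" "\<And>y. y \<in> W \<Longrightarrow> f y = h y"
  shows "v f = v h"
proof (cases "smooth_near A x f")
  case True
  have h: "smooth_near A x h" by (rule smooth_near_cong[OF assms True])
  obtain U \<phi> w where c: "(U, \<phi>) \<in> A" "x \<in> U" "v = directional_derivative A (U, \<phi>) x w"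
    by (rule tangent_rep)
  have "(h \<circ> inv_into U \<phi> has_derivative frechet_derivative (f \<circ> inv_into U \<phi>) (at (\<phi> x))) (at (\<phi> x))"
    by (rule has_derivative_transform_within_open[OF
          smooth_at_chart[OF c(1) True c(2), unfolded frechet_derivative_works]
          chart_image_open_Int[OF c(1) assms(1)]])
      (use assms c in \<open>auto simp: inv_chart[OF c(1)]\<close>)
  from frechet_derivative_at[OF this] True h show ?thesis
    by (simp add: c(3) directional_derivative_def)
next
  case False
  then have "\<not> smooth_near A x h" using smooth_near_cong[OF assms(1,2), of h f] assms(3) by auto
  with False show ?thesis by (simp add: tangent_not_smooth)
qed

lemma tangent_add:
  assumes "smooth_near A x f" "smooth_near A x h"
  shows "v (\<lambda>y. f y + h y) = v f + v h"
proof (rule tangent_rep)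
  fix U \<phi> w assume c: "(U, \<phi>) \<in> A" "x \<in> U" "v = directional_derivative A (U, \<phi>) x w"
  show ?thesis
    using fun_cong[OF frechet_derivative_at[OF has_derivative_add[OF
        smooth_at_chart[OF c(1) assms(1) c(2), unfolded frechet_derivative_works]
        smooth_at_chart[OF c(1) assms(2) c(2), unfolded frechet_derivative_works]]], of w]
      smooth_near_arith(1)[OF assms] assms
    by (simp add: c(3) directional_derivative_def o_def)
qed

lemma tangent_mult:
  assumes "smooth_near A x f" "smooth_near A x h"
  shows "v (\<lambda>y. f y * h y) = v f * h x + f x * v h"
proof (rule tangent_rep)
  fix U \<phi> w assume c: "(U, \<phi>) \<in> A" "x \<in> U" "v = directional_derivative A (U, \<phi>) x w"
  show ?thesis
    using fun_cong[OF frechet_derivative_at[OF has_derivative_mult[OF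
        smooth_at_chart[OF c(1) assms(1) c(2), unfolded frechet_derivative_works]
        smooth_at_chart[OF c(1) assms(2) c(2), unfolded frechet_derivative_works]]], of w]
      smooth_near_arith(2)[OF assms] assms inv_chart[OF c(1,2)]
    by (simp add: c(3) directional_derivative_def o_def)
qed

lemma tangent_minus:
  assumes "smooth_near A x f"
  shows "v (\<lambda>y. - f y) = - v f"
proof -
  have "smooth_near A x (\<lambda>y. - 1)"
    by (auto simp: smooth_near_def intro!: exI[of _ UNIV] smooth_function_on_const)
  from tangent_mult[OF this assms] show ?thesis by (simp add: tangent_const)
qed

end

lemma smooth_near_minus: "smooth_near A x f \<Longrightarrow> smooth_near A x (\<lambda>y. - f y)"
  by (auto simp: smooth_near_def intro: smooth_function_on_minus)

lemma tangent_diff: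
  assumes "v \<in> tangent_space A x" "smooth_near A x f" "smooth_near A x h"
  shows "v (\<lambda>y. f y - h y) = v f - v h"
  using tangent_add[OF assms(1,2) smooth_near_minus[OF assms(3)]] tangent_minus[OF assms(1,3)] by simp

lemma tangent_cmult:
  assumes "v \<in> tangent_space A x" "smooth_near A x f"
  shows "v (\<lambda>y. c * f y) = c * v f"
proof -
  have "smooth_near A x (\<lambda>y. c)"
    by (rule smooth_near_I[OF smooth_function_on_const[OF open_UNIV]]) simp
  from tangent_mult[OF assms(1) this assms(2)] show ?thesis by (simp add: tangent_const[OF assms(1)])
qed

context
  fixes x \<alpha> assumes \<alpha>: "covector A x \<alpha>"
begin

lemma covector_add: "v \<in> tangent_space A x \<Longrightarrow> w \<in> tangent_space A x \<Longrightarrow> \<alpha> (v + w) = \<alpha> v + \<alpha> w"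
  by (rule \<alpha>[unfolded covector_def, THEN conjunct1, rule_format])

lemma covector_scale: "v \<in> tangent_space A x \<Longrightarrow> \<alpha> (r *\<^sub>R v) = r * \<alpha> v"
  by (rule \<alpha>[unfolded covector_def, THEN conjunct2, rule_format])

lemma covector_zero: "\<alpha> 0 = 0"
  using covector_scale[OF subspace_0[OF subspace_tangent_space], of 0] by simp

lemma covector_minus: "v \<in> tangent_space A x \<Longrightarrow> \<alpha> (- v) = - \<alpha> v"
  using covector_scale[of v "- 1"] by simp

lemma covector_diff: "v \<in> tangent_space A x \<Longrightarrow> w \<in> tangent_space A x \<Longrightarrow> \<alpha> (v - w) = \<alpha> v - \<alpha> w"
  using covector_add[OF _ subspace_neg[OF subspace_tangent_space]] covector_minus by simp

lemma covector_sum: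
  "(\<And>i. i \<in> I \<Longrightarrow> e i \<in> tangent_space A x) \<Longrightarrow> \<alpha> (\<Sum>i\<in>I. e i) = (\<Sum>i\<in>I. \<alpha> (e i))"
proof (induction I rule: infinite_finite_induct)
  case (insert i I)
  then have "(\<Sum>i\<in>I. e i) \<in> tangent_space A x"
    by (intro subspace_sum[OF subspace_tangent_space]) simp
  then have "\<alpha> (e i + (\<Sum>i\<in>I. e i)) = \<alpha> (e i) + \<alpha> (\<Sum>i\<in>I. e i)"
    by (intro covector_add) (simp_all add: insert)
  with insert.IH insert.prems show ?case by (simp only: sum.insert[OF insert.hyps] insert_iff simp_thms)
qed (simp_all add: covector_zero)

end

lemma one_form_covector: "one_form A \<theta> \<Longrightarrow> covector A x (\<theta> x)"
  by (simp add: one_form_def)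

lemma one_form_smooth:
  "one_form A \<theta> \<Longrightarrow> vector_field_on A W X \<Longrightarrow> smooth_function_on A W (\<lambda>x. \<theta> x (X x))"
  by (simp add: one_form_def)

section \<open>Vector fields and the Lie bracket\<close>

lemma vector_field_on_open: "vector_field_on A W X \<Longrightarrow> open W"
  by (simp add: vector_field_on_def)

lemma vector_field_on_tangent: "vector_field_on A W X \<Longrightarrow> x \<in> W \<Longrightarrow> X x \<in> tangent_space A x"
  by (simp add: vector_field_on_def)

lemma vector_field_on_smooth:
  "vector_field_on A W X \<Longrightarrow> V \<subseteq> W \<Longrightarrow> smooth_function_on A V f \<Longrightarrow> smooth_function_on A V (\<lambda>x. X x f)"
  by (simp add: vector_field_on_def)

lemma vector_field_on_subset:
  "vector_field_on A W X \<Longrightarrow> open V \<Longrightarrow> V \<subseteq> W \<Longrightarrow> vector_field_on A V X"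
  unfolding vector_field_on_def by blast

lemma vector_field_on_cong:
  assumes "vector_field_on A W X" "\<And>x. x \<in> W \<Longrightarrow> X x = Y x"
  shows "vector_field_on A W Y"
  unfolding vector_field_on_def
proof (intro conjI allI impI ballI)
  fix V f assume *: "V \<subseteq> W \<and> smooth_function_on A V f"
  then have "smooth_function_on A V (\<lambda>x. X x f)" using vector_field_on_smooth[OF assms(1)] by blast
  then show "smooth_function_on A V (\<lambda>x. Y x f)"
    by (rule smooth_function_on_cong) (use * assms(2) in auto)
qed (use assms in \<open>auto simp: vector_field_on_def\<close>)

lemma vector_field_on_add:
  assumes "vector_field_on A W X" "vector_field_on A W Y"
  shows "vector_field_on A W (\<lambda>x. X x + Y x)"
  using assms subspace_add[OF subspace_tangent_space] smooth_function_on_add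
  unfolding vector_field_on_def by auto

lemma vector_field_on_scale:
  assumes "smooth_function_on A W f" "vector_field_on A W X"
  shows "vector_field_on A W (\<lambda>x. f x *\<^sub>R X x)"
  using assms subspace_scale[OF subspace_tangent_space]
    smooth_function_on_mult[OF smooth_function_on_subset[OF assms(1)]] smooth_function_on_open
  unfolding vector_field_on_def by (auto simp: scaleR_fun_def)

lemma vector_field_on_zero: "open W \<Longrightarrow> vector_field_on A W (\<lambda>x. 0)"
  using subspace_0[OF subspace_tangent_space] smooth_function_on_const smooth_function_on_open
  unfolding vector_field_on_def by (auto simp: zero_fun_def)

lemma vector_field_on_minus:
  assumes "vector_field_on A W X"
  shows "vector_field_on A W (\<lambda>x. - X x)"
  using vector_field_on_scale[OF smooth_function_on_const[OF vector_field_on_open[OF assms], of "-1"] assms]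
  by simp

lemma vector_field_on_diff:
  assumes "vector_field_on A W X" "vector_field_on A W Y"
  shows "vector_field_on A W (\<lambda>x. X x - Y x)"
  using vector_field_on_add[OF assms(1) vector_field_on_minus[OF assms(2)]] by simp

lemma vector_field_on_sum:
  assumes "open W" "\<And>i. i \<in> I \<Longrightarrow> vector_field_on A W (E i)"
  shows "vector_field_on A W (\<lambda>x. \<Sum>i\<in>I. E i x)"
  using assms(2)
  by (induction I rule: infinite_finite_induct)
    (auto simp: vector_field_on_zero[OF assms(1)] intro!: vector_field_on_add)

lemma vector_field_on_commute_smooth:
  "vector_field_on A W X \<Longrightarrow> x \<in> W \<Longrightarrow> smooth_near A x f \<Longrightarrow> smooth_near A x (\<lambda>y. X y f)"
proof -
  assume X: "vector_field_on A W X" "x \<in> W" and "smooth_near A x f"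
  then obtain V where V: "x \<in> V" "smooth_function_on A V f" by (auto simp: smooth_near_def)
  have "smooth_function_on A (V \<inter> W) f"
    by (rule smooth_function_on_subset[OF V(2)])
      (use vector_field_on_open[OF X(1)] smooth_function_on_open[OF V(2)] in auto)
  from vector_field_on_smooth[OF X(1) _ this] show ?thesis
    using V X by (auto intro: smooth_near_I)
qed

text \<open>An identity of HOL functions: on arguments that are not smooth near \<open>x\<close> all terms vanish, those
  of the bracket by definition and \<open>X x\<close> because it is a tangent vector.\<close>

lemma lie_bracket_scale:
  assumes "smooth_function_on A W f" "vector_field_on A W X" "vector_field_on A W Y" "x \<in> W"
  shows "lie_bracket A (\<lambda>y. f y *\<^sub>R X y) Y x = f x *\<^sub>R lie_bracket A X Y x - Y x f *\<^sub>R X x"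
proof
  fix h
  show "lie_bracket A (\<lambda>y. f y *\<^sub>R X y) Y x h = (f x *\<^sub>R lie_bracket A X Y x - Y x f *\<^sub>R X x) h"
  proof (cases "smooth_near A x h")
    case True
    have "Y x (\<lambda>y. f y * X y h) = Y x f * X x h + f x * Y x (\<lambda>y. X y h)"
      using tangent_mult[OF vector_field_on_tangent[OF assms(3,4)] smooth_near_I[OF assms(1,4)]
          vector_field_on_commute_smooth[OF assms(2,4) True]] .
    with True show ?thesis by (simp add: lie_bracket_def scaleR_fun_def algebra_simps)
  next
    case False
    then show ?thesis
      using tangent_not_smooth[OF vector_field_on_tangent[OF assms(2,4)]]
      by (simp add: lie_bracket_def scaleR_fun_def)
  qed
qed

lemma lie_bracket_add:
  assumes "vector_field_on A W X" "vector_field_on A W X'" "vector_field_on A W Y" "x \<in> W"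
  shows "lie_bracket A (\<lambda>y. X y + X' y) Y x = lie_bracket A X Y x + lie_bracket A X' Y x"
proof
  fix h
  show "lie_bracket A (\<lambda>y. X y + X' y) Y x h = (lie_bracket A X Y x + lie_bracket A X' Y x) h"
    using tangent_add[OF vector_field_on_tangent[OF assms(3,4)]
        vector_field_on_commute_smooth[OF assms(1,4)] vector_field_on_commute_smooth[OF assms(2,4)]]
    by (auto simp: lie_bracket_def)
qed

lemma lie_bracket_swap: "lie_bracket A X Y x = - lie_bracket A Y X x"
  by (auto simp: lie_bracket_def fun_eq_iff)

text \<open>On smooth functions the cyclic sum expands to twelve third-order terms that cancel in pairs.\<close>

lemma lie_bracket_jacobi:
  assumes "vector_field_on A W X" "vector_field_on A W Y" "vector_field_on A W Z" "x \<in> W"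
  shows "lie_bracket A X (lie_bracket A Y Z) x + lie_bracket A Y (lie_bracket A Z X) x
       + lie_bracket A Z (lie_bracket A X Y) x = 0"
proof
  fix f
  have key: "lie_bracket A P (lie_bracket A Q R) x f =
      P x (\<lambda>y. Q y (\<lambda>z. R z f)) - P x (\<lambda>y. R y (\<lambda>z. Q z f))
      - (Q x (\<lambda>y. R y (\<lambda>z. P z f)) - R x (\<lambda>y. Q y (\<lambda>z. P z f)))"
    if f: "smooth_near A x f"
      and PQR: "vector_field_on A W P" "vector_field_on A W Q" "vector_field_on A W R" for P Q R
  proof -
    obtain V where V: "x \<in> V" "smooth_function_on A V f" using f by (auto simp: smooth_near_def)
    let ?S = "\<lambda>T. smooth_near A x T"
    have s: "?S (\<lambda>y. P y f)" "?S (\<lambda>y. Q y f)" "?S (\<lambda>y. R y f)"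
      using vector_field_on_commute_smooth PQR assms(4) f by auto
    have "P x (\<lambda>y. lie_bracket A Q R y f) = P x (\<lambda>y. Q y (\<lambda>z. R z f) - R y (\<lambda>z. Q z f))"
      by (rule tangent_cong[OF vector_field_on_tangent[OF PQR(1) assms(4)]
            smooth_function_on_open[OF V(2)] V(1)])
        (auto simp: lie_bracket_def smooth_near_I[OF V(2)])
    also have "\<dots> = P x (\<lambda>y. Q y (\<lambda>z. R z f)) - P x (\<lambda>y. R y (\<lambda>z. Q z f))"
      by (rule tangent_diff[OF vector_field_on_tangent[OF PQR(1) assms(4)]])
        (use vector_field_on_commute_smooth PQR assms(4) s in auto)
    finally show ?thesis using f s by (simp add: lie_bracket_def)
  qed
  show "(lie_bracket A X (lie_bracket A Y Z) x + lie_bracket A Y (lie_bracket A Z X) x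
       + lie_bracket A Z (lie_bracket A X Y) x) f = 0 f"
  proof (cases "smooth_near A x f")
    case True
    then show ?thesis using key[OF True assms(1-3)] key[OF True assms(2,3,1)] key[OF True assms(3,1,2)]
      by simp
  qed (simp add: lie_bracket_def)
qed

end

section \<open>Connections and their curvature\<close>

locale connection = smooth_manifold A
  for A :: "('m::{t2_space, second_countable_topology}, 'e::euclidean_space) chart set" +
  fixes D :: "'m conn"
  assumes is_connection: "is_connection A D"
begin

lemma conn_field:
  "vector_field_on A W X \<Longrightarrow> vector_field_on A W Y \<Longrightarrow> vector_field_on A W (D X Y)"
  using is_connection unfolding is_connection_def by (elim conjE) blast

text \<open>Connections are local: \<open>W\<close> may be any neighbourhood of \<open>x\<close> on which the fields live, so statements
  at \<open>x\<close> can always be moved to a smaller one.\<close>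

lemma conn_cong:
  assumes "vector_field_on A W X" "vector_field_on A W Y" "x \<in> W"
    and eq: "\<And>y. y \<in> W \<Longrightarrow> X y = X' y" "\<And>y. y \<in> W \<Longrightarrow> Y y = Y' y"
  shows "D X Y x = D X' Y' x"
proof -
  have "vector_field_on A W X'" "vector_field_on A W Y'"
    using vector_field_on_cong assms(1,2) eq by blast+
  moreover have "\<forall>y\<in>W. X y = X' y \<and> Y y = Y' y" using eq by simp
  ultimately show ?thesis
    using is_connection assms(1-3) unfolding is_connection_def by (elim conjE) blast
qed

lemma conn_add_left:
  assumes "vector_field_on A W X" "vector_field_on A W X'" "vector_field_on A W Y" "x \<in> W"
  shows "D (\<lambda>y. X y + X' y) Y x = D X Y x + D X' Y x"
  by (rule is_connection[unfolded is_connection_def,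
        THEN conjunct2, THEN conjunct2, THEN conjunct1, rule_format])
    (use assms in simp_all)

lemma conn_add_right:
  assumes "vector_field_on A W X" "vector_field_on A W Y" "vector_field_on A W Y'" "x \<in> W"
  shows "D X (\<lambda>y. Y y + Y' y) x = D X Y x + D X Y' x"
  by (rule is_connection[unfolded is_connection_def,
        THEN conjunct2, THEN conjunct2, THEN conjunct2, THEN conjunct1, rule_format])
    (use assms in simp_all)

lemma conn_scale_left:
  assumes "smooth_function_on A W f" "vector_field_on A W X" "vector_field_on A W Y" "x \<in> W"
  shows "D (\<lambda>y. f y *\<^sub>R X y) Y x = f x *\<^sub>R D X Y x"
  by (rule is_connection[unfolded is_connection_def,
        THEN conjunct2, THEN conjunct2, THEN conjunct2, THEN conjunct2, rule_format, THEN conjunct1])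
    (use assms in simp_all)

lemma conn_scale_right:
  assumes "smooth_function_on A W f" "vector_field_on A W X" "vector_field_on A W Y" "x \<in> W"
  shows "D X (\<lambda>y. f y *\<^sub>R Y y) x = X x f *\<^sub>R Y x + f x *\<^sub>R D X Y x"
  by (rule is_connection[unfolded is_connection_def,
        THEN conjunct2, THEN conjunct2, THEN conjunct2, THEN conjunct2, rule_format, THEN conjunct2])
    (use assms in simp_all)

lemma conn_minus_left:
  assumes "vector_field_on A W X" "vector_field_on A W Y" "x \<in> W"
  shows "D (\<lambda>y. - X y) Y x = - D X Y x"
  using conn_scale_left[OF smooth_function_on_const[OF vector_field_on_open[OF assms(1)], of "- 1"] assms]
  by simp

lemma conn_minus_right:
  assumes "vector_field_on A W X" "vector_field_on A W Y" "x \<in> W"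
  shows "D X (\<lambda>y. - Y y) x = - D X Y x"
  using conn_scale_right[OF smooth_function_on_const[OF vector_field_on_open[OF assms(1)], of "- 1"] assms]
  by (simp add: tangent_const[OF vector_field_on_tangent[OF assms(1,3)]])

lemma conn_diff_left:
  assumes "vector_field_on A W X" "vector_field_on A W X'" "vector_field_on A W Y" "x \<in> W"
  shows "D (\<lambda>y. X y - X' y) Y x = D X Y x - D X' Y x"
  using conn_add_left[OF assms(1) vector_field_on_minus[OF assms(2)] assms(3,4)]
    conn_minus_left[OF assms(2-4)] by simp

lemma conn_diff_right:
  assumes "vector_field_on A W X" "vector_field_on A W Y" "vector_field_on A W Y'" "x \<in> W"
  shows "D X (\<lambda>y. Y y - Y' y) x = D X Y x - D X Y' x"
  using conn_add_right[OF assms(1,2) vector_field_on_minus[OF assms(3)] assms(4)]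
    conn_minus_right[OF assms(1,3,4)] by simp

end

locale torsion_free_connection = connection A D
  for A :: "('m::{t2_space, second_countable_topology}, 'e::euclidean_space) chart set"
    and D :: "'m conn" +
  assumes torsion_free: "vector_field_on A W X \<Longrightarrow> vector_field_on A W Y \<Longrightarrow> x \<in> W \<Longrightarrow>
    D X Y x - D Y X x = lie_bracket A X Y x"
begin

text \<open>The second derivatives in a bracket cancel. Here this is visible without charts, since the bracket
  is a difference of covariant derivatives.\<close>

lemma lie_bracket_field:
  assumes "vector_field_on A W X" "vector_field_on A W Y"
  shows "vector_field_on A W (lie_bracket A X Y)"
  using vector_field_on_diff[OF conn_field[OF assms] conn_field[OF assms(2,1)]] torsion_free[OF assms]
  by (rule vector_field_on_cong)

lemma curvature_field:
  assumes "vector_field_on A W X" "vector_field_on A W Y" "vector_field_on A W Z"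
  shows "vector_field_on A W (curvature A D X Y Z)"
  unfolding curvature_def
  by (intro vector_field_on_diff conn_field lie_bracket_field assms)

lemma curvature_swap:
  assumes "vector_field_on A W X" "vector_field_on A W Y" "vector_field_on A W Z" "x \<in> W"
  shows "curvature A D X Y Z x = - curvature A D Y X Z x"
proof -
  have "D (lie_bracket A X Y) Z x = D (\<lambda>y. - lie_bracket A Y X y) Z x"
    by (rule conn_cong[OF lie_bracket_field[OF assms(1,2)] assms(3,4) lie_bracket_swap refl])
  also have "\<dots> = - D (lie_bracket A Y X) Z x"
    by (rule conn_minus_left[OF lie_bracket_field[OF assms(2,1)] assms(3,4)])
  finally show ?thesis by (simp add: curvature_def)
qed

lemma curvature_add_first:
  assumes "vector_field_on A W X" "vector_field_on A W X'" "vector_field_on A W Y"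
    "vector_field_on A W Z" "x \<in> W"
  shows "curvature A D (\<lambda>y. X y + X' y) Y Z x = curvature A D X Y Z x + curvature A D X' Y Z x"
proof -
  have s: "vector_field_on A W (\<lambda>y. X y + X' y)" by (rule vector_field_on_add[OF assms(1,2)])
  have 1: "D (\<lambda>y. X y + X' y) (D Y Z) x = D X (D Y Z) x + D X' (D Y Z) x"
    by (rule conn_add_left[OF assms(1,2) conn_field[OF assms(3,4)] assms(5)])
  have "D Y (D (\<lambda>y. X y + X' y) Z) x = D Y (\<lambda>y. D X Z y + D X' Z y) x"
    by (rule conn_cong[OF assms(3) conn_field[OF s assms(4)] assms(5) refl conn_add_left[OF assms(1,2,4)]])
  then have 2: "D Y (D (\<lambda>y. X y + X' y) Z) x = D Y (D X Z) x + D Y (D X' Z) x"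
    using conn_add_right[OF assms(3) conn_field[OF assms(1,4)] conn_field[OF assms(2,4)] assms(5)] by simp
  have "D (lie_bracket A (\<lambda>y. X y + X' y) Y) Z x =
      D (\<lambda>y. lie_bracket A X Y y + lie_bracket A X' Y y) Z x"
    by (rule conn_cong[OF lie_bracket_field[OF s assms(3)] assms(4,5) lie_bracket_add[OF assms(1-3)] refl])
  then have 3: "D (lie_bracket A (\<lambda>y. X y + X' y) Y) Z x = D (lie_bracket A X Y) Z x + D (lie_bracket A X' Y) Z x"
    using conn_add_left[OF lie_bracket_field[OF assms(1,3)] lie_bracket_field[OF assms(2,3)] assms(4,5)] by simp
  show ?thesis unfolding curvature_def 1 2 3 by simp
qed

lemma curvature_scale_first:
  assumes "smooth_function_on A W f" "vector_field_on A W X" "vector_field_on A W Y"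
    "vector_field_on A W Z" "x \<in> W"
  shows "curvature A D (\<lambda>y. f y *\<^sub>R X y) Y Z x = f x *\<^sub>R curvature A D X Y Z x"
proof -
  have s: "vector_field_on A W (\<lambda>y. f y *\<^sub>R X y)" by (rule vector_field_on_scale[OF assms(1,2)])
  have Yf: "smooth_function_on A W (\<lambda>y. Y y f)" by (rule vector_field_on_smooth[OF assms(3) order_refl assms(1)])
  have 1: "D (\<lambda>y. f y *\<^sub>R X y) (D Y Z) x = f x *\<^sub>R D X (D Y Z) x"
    by (rule conn_scale_left[OF assms(1,2) conn_field[OF assms(3,4)] assms(5)])
  have "D Y (D (\<lambda>y. f y *\<^sub>R X y) Z) x = D Y (\<lambda>y. f y *\<^sub>R D X Z y) x"
    by (rule conn_cong[OF assms(3) conn_field[OF s assms(4)] assms(5) refl conn_scale_left[OF assms(1,2,4)]])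
  then have 2: "D Y (D (\<lambda>y. f y *\<^sub>R X y) Z) x = Y x f *\<^sub>R D X Z x + f x *\<^sub>R D Y (D X Z) x"
    using conn_scale_right[OF assms(1,3) conn_field[OF assms(2,4)] assms(5)] by simp
  have b: "vector_field_on A W (\<lambda>y. f y *\<^sub>R lie_bracket A X Y y)" "vector_field_on A W (\<lambda>y. Y y f *\<^sub>R X y)"
    by (rule vector_field_on_scale[OF assms(1) lie_bracket_field[OF assms(2,3)]],
        rule vector_field_on_scale[OF Yf assms(2)])
  have "D (lie_bracket A (\<lambda>y. f y *\<^sub>R X y) Y) Z x =
      D (\<lambda>y. f y *\<^sub>R lie_bracket A X Y y - Y y f *\<^sub>R X y) Z x"
    by (rule conn_cong[OF lie_bracket_field[OF s assms(3)] assms(4,5) lie_bracket_scale[OF assms(1-3)] refl])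
  then have 3: "D (lie_bracket A (\<lambda>y. f y *\<^sub>R X y) Y) Z x =
      f x *\<^sub>R D (lie_bracket A X Y) Z x - Y x f *\<^sub>R D X Z x"
    using conn_diff_left[OF b assms(4,5)] conn_scale_left[OF Yf assms(2,4,5)]
      conn_scale_left[OF assms(1) lie_bracket_field[OF assms(2,3)] assms(4,5)] by simp
  show ?thesis unfolding curvature_def 1 2 3 by (simp add: scaleR_diff_right)
qed

lemma curvature_add_third:
  assumes "vector_field_on A W X" "vector_field_on A W Y" "vector_field_on A W Z"
    "vector_field_on A W Z'" "x \<in> W"
  shows "curvature A D X Y (\<lambda>y. Z y + Z' y) x = curvature A D X Y Z x + curvature A D X Y Z' x"
proof -
  have s: "vector_field_on A W (\<lambda>y. Z y + Z' y)" by (rule vector_field_on_add[OF assms(3,4)])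
  have 1: "D P (D Q (\<lambda>y. Z y + Z' y)) x = D P (D Q Z) x + D P (D Q Z') x"
    if "vector_field_on A W P" "vector_field_on A W Q" for P Q
  proof -
    have "D P (D Q (\<lambda>y. Z y + Z' y)) x = D P (\<lambda>y. D Q Z y + D Q Z' y) x"
      by (rule conn_cong[OF that(1) conn_field[OF that(2) s] assms(5) refl conn_add_right[OF that(2) assms(3,4)]])
    then show ?thesis
      using conn_add_right[OF that(1) conn_field[OF that(2) assms(3)] conn_field[OF that(2) assms(4)] assms(5)]
      by simp
  qed
  show ?thesis
    unfolding curvature_def 1[OF assms(1,2)] 1[OF assms(2,1)]
      conn_add_right[OF lie_bracket_field[OF assms(1,2)] assms(3-5)] by simp
qed

text \<open>The second derivatives of \<open>f\<close> combine to \<open>[X, Y] f\<close>, which the term \<open>D\<^bsub>[X, Y]\<^esub> (f Z)\<close> removes.\<close>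

lemma curvature_scale_third:
  assumes "smooth_function_on A W f" "vector_field_on A W X" "vector_field_on A W Y"
    "vector_field_on A W Z" "x \<in> W"
  shows "curvature A D X Y (\<lambda>y. f y *\<^sub>R Z y) x = f x *\<^sub>R curvature A D X Y Z x"
proof -
  have s: "vector_field_on A W (\<lambda>y. f y *\<^sub>R Z y)" by (rule vector_field_on_scale[OF assms(1,4)])
  have 1: "D P (D Q (\<lambda>y. f y *\<^sub>R Z y)) x =
      P x (\<lambda>y. Q y f) *\<^sub>R Z x + Q x f *\<^sub>R D P Z x + (P x f *\<^sub>R D Q Z x + f x *\<^sub>R D P (D Q Z) x)"
    if P: "vector_field_on A W P" and Q: "vector_field_on A W Q" for P Q
  proof -
    have Qf: "smooth_function_on A W (\<lambda>y. Q y f)" by (rule vector_field_on_smooth[OF Q order_refl assms(1)])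
    have "D P (D Q (\<lambda>y. f y *\<^sub>R Z y)) x = D P (\<lambda>y. Q y f *\<^sub>R Z y + f y *\<^sub>R D Q Z y) x"
      by (rule conn_cong[OF P conn_field[OF Q s] assms(5) refl conn_scale_right[OF assms(1) Q assms(4)]])
    also have "\<dots> = D P (\<lambda>y. Q y f *\<^sub>R Z y) x + D P (\<lambda>y. f y *\<^sub>R D Q Z y) x"
      by (rule conn_add_right[OF P vector_field_on_scale[OF Qf assms(4)]
            vector_field_on_scale[OF assms(1) conn_field[OF Q assms(4)]] assms(5)])
    finally show ?thesis
      using conn_scale_right[OF Qf P assms(4,5)] conn_scale_right[OF assms(1) P conn_field[OF Q assms(4)] assms(5)]
      by simp
  qed
  have 2: "lie_bracket A X Y x f = X x (\<lambda>y. Y y f) - Y x (\<lambda>y. X y f)"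
    using smooth_near_I[OF assms(1,5)] by (simp add: lie_bracket_def)
  show ?thesis
    unfolding curvature_def 1[OF assms(2,3)] 1[OF assms(3,2)]
      conn_scale_right[OF assms(1) lie_bracket_field[OF assms(2,3)] assms(4,5)] 2
    by (simp add: scaleR_diff_right scaleR_diff_left)
qed

lemma curvature_cong:
  assumes "vector_field_on A W X" "vector_field_on A W Y" "vector_field_on A W Z" "x \<in> W"
    and eq: "\<And>y. y \<in> W \<Longrightarrow> X y = X' y" "\<And>y. y \<in> W \<Longrightarrow> Y y = Y' y" "\<And>y. y \<in> W \<Longrightarrow> Z y = Z' y"
  shows "curvature A D X Y Z x = curvature A D X' Y' Z' x"
proof -
  have 1: "D X (D Y Z) x = D X' (D Y' Z') x"
    by (rule conn_cong[OF assms(1) conn_field[OF assms(2,3)] assms(4) eq(1)])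
      (auto intro!: conn_cong[OF assms(2,3)] eq)
  have 2: "D Y (D X Z) x = D Y' (D X' Z') x"
    by (rule conn_cong[OF assms(2) conn_field[OF assms(1,3)] assms(4) eq(2)])
      (auto intro!: conn_cong[OF assms(1,3)] eq)
  have X': "vector_field_on A W X'" "vector_field_on A W Y'"
    using vector_field_on_cong assms(1,2) eq by blast+
  have "lie_bracket A X Y y = lie_bracket A X' Y' y" if "y \<in> W" for y
    using torsion_free[OF assms(1,2) that] torsion_free[OF X' that]
      conn_cong[OF assms(1,2) that eq(1,2)] conn_cong[OF assms(2,1) that eq(2,1)] by simp
  then have 3: "D (lie_bracket A X Y) Z x = D (lie_bracket A X' Y') Z' x"
    by (intro conn_cong[OF lie_bracket_field[OF assms(1,2)] assms(3,4)] eq)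
  show ?thesis unfolding curvature_def 1 2 3 ..
qed

text \<open>Grouping the cyclic sum by the outer derivative turns the inner differences into brackets, by
  vanishing torsion. Using vanishing torsion once more leaves the Jacobi identity.\<close>

lemma first_bianchi:
  assumes X: "vector_field_on A W X" and Y: "vector_field_on A W Y" and Z: "vector_field_on A W Z"
    and x: "x \<in> W"
  shows "curvature A D X Y Z x + curvature A D Y Z X x + curvature A D Z X Y x = 0"
proof -
  \<comment> \<open>the outer derivative of \<open>D\<^sub>Q R - D\<^sub>R Q = [Q, R]\<close>\<close>
  have key: "D P (D Q R) x - D P (D R Q) x = D (lie_bracket A Q R) P x + lie_bracket A P (lie_bracket A Q R) x"
    if P: "vector_field_on A W P" and Q: "vector_field_on A W Q" and R: "vector_field_on A W R" for P Q R
  proof -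
    have "D P (D Q R) x - D P (D R Q) x = D P (\<lambda>y. D Q R y - D R Q y) x"
      using conn_diff_right[OF P conn_field[OF Q R] conn_field[OF R Q] x] by simp
    also have "\<dots> = D P (lie_bracket A Q R) x"
      by (rule conn_cong[OF P vector_field_on_diff[OF conn_field[OF Q R] conn_field[OF R Q]] x refl torsion_free[OF Q R]])
    finally show ?thesis using torsion_free[OF P lie_bracket_field[OF Q R] x] by (simp add: algebra_simps)
  qed
  have "curvature A D X Y Z x + curvature A D Y Z X x + curvature A D Z X Y x =
      (D X (D Y Z) x - D X (D Z Y) x - D (lie_bracket A Y Z) X x) +
      (D Y (D Z X) x - D Y (D X Z) x - D (lie_bracket A Z X) Y x) +
      (D Z (D X Y) x - D Z (D Y X) x - D (lie_bracket A X Y) Z x)"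
    by (simp add: curvature_def algebra_simps)
  also have "\<dots> = lie_bracket A X (lie_bracket A Y Z) x + lie_bracket A Y (lie_bracket A Z X) x
      + lie_bracket A Z (lie_bracket A X Y) x"
    unfolding key[OF X Y Z] key[OF Y Z X] key[OF Z X Y] by simp
  finally show ?thesis using lie_bracket_jacobi[OF X Y Z x] by simp
qed

end

section \<open>Bases, coordinates and the trace\<close>

lemma span_image_eq_sum:
  fixes f :: "'i \<Rightarrow> 'v::real_vector"
  assumes "finite I" "v \<in> span (f ` I)"
  shows "\<exists>c. v = (\<Sum>i\<in>I. c i *\<^sub>R f i)"
  using assms
proof (induction I arbitrary: v)
  case empty
  then show ?case by simp
next
  case (insert i I)
  then obtain k where "v - k *\<^sub>R f i \<in> span (f ` I)"
    by (auto simp: span_breakdown_eq)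
  then obtain c where c: "v - k *\<^sub>R f i = (\<Sum>j\<in>I. c j *\<^sub>R f j)"
    using insert.IH by blast
  have "(\<Sum>j\<in>I. c j *\<^sub>R f j) = (\<Sum>j\<in>I. (c(i := k)) j *\<^sub>R f j)"
    using insert.hyps by (intro sum.cong) auto
  with c have "v = (\<Sum>j\<in>insert i I. (c(i := k)) j *\<^sub>R f j)"
    unfolding sum.insert[OF insert.hyps] by (simp add: algebra_simps)
  then show ?case by blast
qed

lemma linear_on_subspace_sum:
  fixes f :: "'v::real_vector \<Rightarrow> 'w::real_vector"
  assumes V: "subspace V"
    and add: "\<And>u v. u \<in> V \<Longrightarrow> v \<in> V \<Longrightarrow> f (u + v) = f u + f v"
    and scale: "\<And>r v. v \<in> V \<Longrightarrow> f (r *\<^sub>R v) = r *\<^sub>R f v"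
    and u: "\<And>i. i \<in> I \<Longrightarrow> u i \<in> V"
  shows "f (\<Sum>i\<in>I. c i *\<^sub>R u i) = (\<Sum>i\<in>I. c i *\<^sub>R f (u i))"
proof -
  have zero: "f 0 = 0" using scale[OF subspace_0[OF V], of 0] by simp
  show ?thesis using u
  proof (induction I rule: infinite_finite_induct)
    case (insert i I)
    have "f (c i *\<^sub>R u i + (\<Sum>i\<in>I. c i *\<^sub>R u i)) = f (c i *\<^sub>R u i) + f (\<Sum>i\<in>I. c i *\<^sub>R u i)"
      using insert.prems by (intro add subspace_scale[OF V] subspace_sum[OF V]) auto
    then show ?case
      using insert.IH insert.prems by (simp add: sum.insert[OF insert.hyps] scale)
  qed (simp_all add: zero)
qed

text \<open>The basis \<open>B\<close> chosen in \<^const>\<open>trace_on\<close> is eliminated by expanding each \<open>b \<in> B\<close> in the \<open>e i\<close>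
  and each \<open>L (e i)\<close> in \<open>B\<close>, and exchanging the two sums.\<close>

lemma trace_on_eq_sum_coordinates:
  fixes V :: "'v::real_vector set" and L :: "'v \<Rightarrow> 'v" and \<phi> :: "'i \<Rightarrow> 'v \<Rightarrow> real"
  assumes V: "subspace V" and I: "finite I" and e: "\<And>i. i \<in> I \<Longrightarrow> e i \<in> V"
    and expand: "\<And>v. v \<in> V \<Longrightarrow> v = (\<Sum>i\<in>I. \<phi> i v *\<^sub>R e i)"
    and \<phi>_add: "\<And>i u v. i \<in> I \<Longrightarrow> u \<in> V \<Longrightarrow> v \<in> V \<Longrightarrow> \<phi> i (u + v) = \<phi> i u + \<phi> i v"
    and \<phi>_scale: "\<And>i r v. i \<in> I \<Longrightarrow> v \<in> V \<Longrightarrow> \<phi> i (r *\<^sub>R v) = r * \<phi> i v"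
    and L: "\<And>v. v \<in> V \<Longrightarrow> L v \<in> V"
    and L_add: "\<And>u v. u \<in> V \<Longrightarrow> v \<in> V \<Longrightarrow> L (u + v) = L u + L v"
    and L_scale: "\<And>r v. v \<in> V \<Longrightarrow> L (r *\<^sub>R v) = r *\<^sub>R L v"
  shows "trace_on V L = (\<Sum>i\<in>I. \<phi> i (L (e i)))"
proof -
  define B where "B = (SOME B. independent B \<and> span B = V)"
  have "\<exists>B. independent B \<and> span B = V"
  proof -
    obtain B where "B \<subseteq> V" "independent B" "V \<subseteq> span B"
      by (rule maximal_independent_subset)
    then show ?thesis using span_minimal[OF _ V] by blast
  qed
  then have B: "independent B" "span B = V"
    using someI_ex[of "\<lambda>B. independent B \<and> span B = V"] unfolding B_def by blast+
  have BV: "b \<in> V" if "b \<in> B" for b using that B(2) span_base by blast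
  have "B \<subseteq> span (e ` I)"
  proof
    fix b assume "b \<in> B"
    then have "b = (\<Sum>i\<in>I. \<phi> i b *\<^sub>R e i)" by (intro expand BV)
    also have "\<dots> \<in> span (e ` I)" by (intro span_sum span_scale span_base) simp
    finally show "b \<in> span (e ` I)" .
  qed
  then have fin: "finite B" using independent_span_bound[of "e ` I" B] I B(1) by blast
  have Le: "L (e i) \<in> span B" if "i \<in> I" for i using that L e B(2) by simp
  have rep: "representation B (L b) b = (\<Sum>i\<in>I. \<phi> i b * representation B (L (e i)) b)" if "b \<in> B" for b
  proof -
    have "L b = L (\<Sum>i\<in>I. \<phi> i b *\<^sub>R e i)" using expand[OF BV[OF that]] by simp
    also have "\<dots> = (\<Sum>i\<in>I. \<phi> i b *\<^sub>R L (e i))"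
      by (rule linear_on_subspace_sum[OF V L_add L_scale e])
    finally have "representation B (L b) = (\<lambda>b'. \<Sum>i\<in>I. representation B (\<phi> i b *\<^sub>R L (e i)) b')"
      using representation_sum[OF B(1), of I "\<lambda>i. \<phi> i b *\<^sub>R L (e i)"] Le span_scale by metis
    then show ?thesis using representation_scale[OF B(1) Le] by simp
  qed
  have "\<phi> i (L (e i)) = (\<Sum>b\<in>B. \<phi> i b * representation B (L (e i)) b)" if "i \<in> I" for i
  proof -
    have "L (e i) = (\<Sum>b\<in>B. representation B (L (e i)) b *\<^sub>R b)"
      using sum_representation_eq[OF B(1) Le[OF that] fin order_refl] by simp
    then have "\<phi> i (L (e i)) = \<phi> i (\<Sum>b\<in>B. representation B (L (e i)) b *\<^sub>R b)" by simp
    also have "\<dots> = (\<Sum>b\<in>B. representation B (L (e i)) b *\<^sub>R \<phi> i b)"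
      by (rule linear_on_subspace_sum[OF V \<phi>_add[OF that]]) (simp_all add: \<phi>_scale[OF that] BV)
    finally show ?thesis by (simp add: mult.commute)
  qed
  then have "(\<Sum>i\<in>I. \<phi> i (L (e i))) = (\<Sum>i\<in>I. \<Sum>b\<in>B. \<phi> i b * representation B (L (e i)) b)"
    by simp
  also have "\<dots> = (\<Sum>b\<in>B. \<Sum>i\<in>I. \<phi> i b * representation B (L (e i)) b)" by (rule sum.swap)
  also have "\<dots> = (\<Sum>b\<in>B. representation B (L b) b)" using rep by simp
  finally show ?thesis by (simp add: trace_on_def Let_def B_def)
qed

section \<open>Metrics and orthogonal frames\<close>

context smooth_manifold
begin

lemma extend_in_span:
  assumes W: "open W" and I: "finite I" and F: "\<And>i. i \<in> I \<Longrightarrow> vector_field_on A W (F i)"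
    and v: "v \<in> span ((\<lambda>i. F i x) ` I)"
  obtains V where "vector_field_on A W V" "V x = v" "\<And>y. V y \<in> span ((\<lambda>i. F i y) ` I)"
proof -
  obtain c where c: "v = (\<Sum>i\<in>I. c i *\<^sub>R F i x)" using span_image_eq_sum[OF I v] by blast
  show ?thesis
  proof (rule that[of "\<lambda>y. \<Sum>i\<in>I. c i *\<^sub>R F i y"])
    show "vector_field_on A W (\<lambda>y. \<Sum>i\<in>I. c i *\<^sub>R F i y)"
      by (intro vector_field_on_sum[OF W] vector_field_on_scale F smooth_function_on_const[OF W])
    show "(\<Sum>i\<in>I. c i *\<^sub>R F i y) \<in> span ((\<lambda>i. F i y) ` I)" for y
      by (intro span_sum span_scale span_base) simp
  qed (simp add: c)
qed

lemma distribution_subspace: "distribution A r T \<Longrightarrow> subspace (T x)"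
  and distribution_tangent: "distribution A r T \<Longrightarrow> T x \<subseteq> tangent_space A x"
  and distribution_dim: "distribution A r T \<Longrightarrow> dim (T x) = r"
  unfolding distribution_def by blast+

lemma distribution_fields:
  assumes "distribution A r T"
  obtains W F where "open W" "x \<in> W" "\<And>i. i < r \<Longrightarrow> vector_field_on A W (F i)"
    "\<And>y. y \<in> W \<Longrightarrow> T y = span ((\<lambda>i. F i y) ` {..<r})"
proof -
  have "\<exists>W E. open W \<and> x \<in> W \<and> (\<forall>i<r. vector_field_on A W (E i)) \<and>
        (\<forall>y\<in>W. T y = span ((\<lambda>i. E i y) ` {..<r}))"
    using assms unfolding distribution_def by blast
  then show ?thesis using that by blast
qed

lemma distribution_extend:
  assumes "distribution A r T" "v \<in> T x"
  obtains W V where "x \<in> W" "vector_field_on A W V" "V x = v" "\<And>y. y \<in> W \<Longrightarrow> V y \<in> T y"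
proof -
  obtain W F where F: "open W" "x \<in> W" "\<And>i. i < r \<Longrightarrow> vector_field_on A W (F i)"
    "\<And>y. y \<in> W \<Longrightarrow> T y = span ((\<lambda>i. F i y) ` {..<r})"
    using distribution_fields[OF assms(1), where x = x] by metis
  have "v \<in> span ((\<lambda>i. F i x) ` {..<r})" using assms(2) F(2,4) by simp
  then obtain V where "vector_field_on A W V" "V x = v" "\<And>y. V y \<in> span ((\<lambda>i. F i y) ` {..<r})"
    using extend_in_span[of W "{..<r}" F v x] F(1,3) by auto
  then show ?thesis using that F(2,4) by blast
qed

end

locale riemannian_manifold = smooth_manifold A
  for A :: "('m::{t2_space, second_countable_topology}, 'e::euclidean_space) chart set" +
  fixes g :: "'m metric"
  assumes metric: "riemannian_metric A g"
begin

lemma metric_covector: "v \<in> tangent_space A x \<Longrightarrow> covector A x (g x v)"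
  using metric unfolding riemannian_metric_def by (elim conjE) blast

lemma metric_sym: "v \<in> tangent_space A x \<Longrightarrow> w \<in> tangent_space A x \<Longrightarrow> g x v w = g x w v"
  using metric unfolding riemannian_metric_def by (elim conjE) blast

lemma metric_pos: "v \<in> tangent_space A x \<Longrightarrow> v \<noteq> 0 \<Longrightarrow> g x v v > 0"
  using metric unfolding riemannian_metric_def by (elim conjE) blast

lemma metric_smooth:
  "vector_field_on A W X \<Longrightarrow> vector_field_on A W Y \<Longrightarrow> smooth_function_on A W (\<lambda>x. g x (X x) (Y x))"
  by (rule metric[unfolded riemannian_metric_def, THEN conjunct2, THEN conjunct2, THEN conjunct2,
        rule_format]) simp

lemma metric_covector_left:
  assumes "w \<in> tangent_space A x"
  shows "covector A x (\<lambda>v. g x v w)"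
  unfolding covector_def
proof (intro conjI allI ballI)
  fix u v assume uv: "u \<in> tangent_space A x" "v \<in> tangent_space A x"
  then have "g x w (u + v) = g x w u + g x w v"
    by (rule covector_add[OF metric_covector[OF assms]])
  then show "g x (u + v) w = g x u w + g x v w"
    using uv assms subspace_add[OF subspace_tangent_space uv] by (simp add: metric_sym)
next
  fix r v assume v: "v \<in> tangent_space A x"
  then have "g x w (r *\<^sub>R v) = r * g x w v"
    by (rule covector_scale[OF metric_covector[OF assms]])
  then show "g x (r *\<^sub>R v) w = r * g x v w"
    using v assms subspace_scale[OF subspace_tangent_space v] by (simp add: metric_sym)
qed

definition orthogonal_fields :: "'m set \<Rightarrow> 'i set \<Rightarrow> ('i \<Rightarrow> 'm vfield) \<Rightarrow> bool" where
  "orthogonal_fields W I E \<longleftrightarrow> open W \<and> finite I \<and> (\<forall>i\<in>I. vector_field_on A W (E i)) \<and>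
     (\<forall>y\<in>W. (\<forall>i\<in>I. E i y \<noteq> 0) \<and> (\<forall>i\<in>I. \<forall>j\<in>I. i \<noteq> j \<longrightarrow> g y (E i y) (E j y) = 0))"

text \<open>The frames below are orthogonal but not normalised: dividing by \<open>g(E, E)\<close> keeps coordinates
  smooth without any appeal to square roots.\<close>

definition coordinate :: "'m vfield \<Rightarrow> 'm \<Rightarrow> 'm tvec \<Rightarrow> real" where
  "coordinate E y v = g y v (E y) / g y (E y) (E y)"

definition projection :: "'i set \<Rightarrow> ('i \<Rightarrow> 'm vfield) \<Rightarrow> 'm \<Rightarrow> 'm tvec \<Rightarrow> 'm tvec" where
  "projection I E y v = (\<Sum>i\<in>I. coordinate (E i) y v *\<^sub>R E i y)"

definition orthogonal_frame ::
    "('m \<Rightarrow> 'm tvec set) \<Rightarrow> 'm set \<Rightarrow> 'i set \<Rightarrow> ('i \<Rightarrow> 'm vfield) \<Rightarrow> bool" where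
  "orthogonal_frame T W I E \<longleftrightarrow>
     orthogonal_fields W I E \<and> (\<forall>y\<in>W. T y = span ((\<lambda>i. E i y) ` I))"

lemma projection_in_span: "projection I E y v \<in> span ((\<lambda>i. E i y) ` I)"
  unfolding projection_def by (intro span_sum span_scale span_base) simp

lemma coordinate_add:
  assumes "E y \<in> tangent_space A y" "u \<in> tangent_space A y" "v \<in> tangent_space A y"
  shows "coordinate E y (u + v) = coordinate E y u + coordinate E y v"
  using covector_add[OF metric_covector_left[OF assms(1)] assms(2,3)]
  by (simp add: coordinate_def add_divide_distrib)

lemma coordinate_scale:
  assumes "E y \<in> tangent_space A y" "v \<in> tangent_space A y"
  shows "coordinate E y (r *\<^sub>R v) = r * coordinate E y v"
  using covector_scale[OF metric_covector_left[OF assms(1)] assms(2)]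
  by (simp add: coordinate_def)

context
  fixes W and I :: "'i set" and E assumes orth: "orthogonal_fields W I E"
begin

lemma orth_open: "open W" and orth_finite: "finite I"
  and orth_field: "i \<in> I \<Longrightarrow> vector_field_on A W (E i)"
  using orth unfolding orthogonal_fields_def by blast+

lemma orth_nonzero: "y \<in> W \<Longrightarrow> i \<in> I \<Longrightarrow> E i y \<noteq> 0"
  and orth_zero: "y \<in> W \<Longrightarrow> i \<in> I \<Longrightarrow> j \<in> I \<Longrightarrow> i \<noteq> j \<Longrightarrow> g y (E i y) (E j y) = 0"
  using orth unfolding orthogonal_fields_def by blast+

lemma orth_tangent: "y \<in> W \<Longrightarrow> i \<in> I \<Longrightarrow> E i y \<in> tangent_space A y"
  using orth_field vector_field_on_tangent by blast

lemma orth_square_nonzero: "y \<in> W \<Longrightarrow> i \<in> I \<Longrightarrow> g y (E i y) (E i y) \<noteq> 0"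
  using metric_pos[OF orth_tangent orth_nonzero] by force

lemma orth_sum:
  assumes "y \<in> W" "i \<in> I"
  shows "g y (\<Sum>j\<in>I. c j *\<^sub>R E j y) (E i y) = c i * g y (E i y) (E i y)"
proof -
  note cv = metric_covector_left[OF orth_tangent[OF assms]]
  have "g y (\<Sum>j\<in>I. c j *\<^sub>R E j y) (E i y) = (\<Sum>j\<in>I. g y (c j *\<^sub>R E j y) (E i y))"
    by (rule covector_sum[OF cv]) (rule subspace_scale[OF subspace_tangent_space orth_tangent[OF assms(1)]])
  also have "\<dots> = (\<Sum>j\<in>I. if j = i then c i * g y (E i y) (E i y) else 0)"
    using orth_zero[OF assms(1) _ assms(2)]
    by (intro sum.cong refl) (simp add: covector_scale[OF cv] orth_tangent[OF assms(1)])
  also have "\<dots> = c i * g y (E i y) (E i y)"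
    using orth_finite assms(2) by simp
  finally show ?thesis .
qed

lemma projection_eq:
  assumes "y \<in> W" "v \<in> span ((\<lambda>i. E i y) ` I)"
  shows "projection I E y v = v"
proof -
  obtain c where c: "v = (\<Sum>i\<in>I. c i *\<^sub>R E i y)"
    using span_image_eq_sum[OF orth_finite assms(2)] by blast
  have "coordinate (E i) y v = c i" if "i \<in> I" for i
    unfolding coordinate_def c orth_sum[OF assms(1) that] using orth_square_nonzero[OF assms(1) that] by simp
  then have "(\<Sum>i\<in>I. coordinate (E i) y v *\<^sub>R E i y) = (\<Sum>i\<in>I. c i *\<^sub>R E i y)"
    by (intro sum.cong) simp_all
  then show ?thesis unfolding projection_def c by simp
qed

lemma projection_tangent: "y \<in> W \<Longrightarrow> projection I E y v \<in> tangent_space A y"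
  unfolding projection_def
  by (intro subspace_sum[OF subspace_tangent_space] subspace_scale[OF subspace_tangent_space] orth_tangent)

lemma projection_residual:
  assumes "y \<in> W" "i \<in> I" "v \<in> tangent_space A y"
  shows "g y (v - projection I E y v) (E i y) = 0"
proof -
  have "g y (v - projection I E y v) (E i y) = g y v (E i y) - g y (projection I E y v) (E i y)"
    by (rule covector_diff[OF metric_covector_left[OF orth_tangent[OF assms(1,2)]] assms(3)
          projection_tangent[OF assms(1)]])
  also have "g y (projection I E y v) (E i y) = g y v (E i y)"
    unfolding projection_def orth_sum[OF assms(1,2)] using orth_square_nonzero[OF assms(1,2)]
    by (simp add: coordinate_def)
  finally show ?thesis by (simp only: diff_self)
qed

lemma coordinate_smooth:
  assumes "vector_field_on A V X" "V \<subseteq> W" "i \<in> I"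
  shows "smooth_function_on A V (\<lambda>y. coordinate (E i) y (X y))"
proof -
  have E: "vector_field_on A V (E i)"
    by (rule vector_field_on_subset[OF orth_field[OF assms(3)] vector_field_on_open[OF assms(1)] assms(2)])
  show ?thesis unfolding coordinate_def
    by (rule smooth_function_on_divide[OF metric_smooth[OF assms(1) E] metric_smooth[OF E E]])
      (use orth_square_nonzero assms in blast)
qed

lemma projection_field:
  assumes "vector_field_on A V X" "V \<subseteq> W"
  shows "vector_field_on A V (\<lambda>y. projection I E y (X y))"
  unfolding projection_def
proof (rule vector_field_on_sum[OF vector_field_on_open[OF assms(1)]])
  fix i assume i: "i \<in> I"
  show "vector_field_on A V (\<lambda>y. coordinate (E i) y (X y) *\<^sub>R E i y)"
    by (rule vector_field_on_scale[OF coordinate_smooth[OF assms i]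
          vector_field_on_subset[OF orth_field[OF i] vector_field_on_open[OF assms(1)] assms(2)]])
qed

lemma orth_inj: "y \<in> W \<Longrightarrow> inj_on (\<lambda>i. E i y) I"
proof (rule inj_onI, rule ccontr)
  fix i j assume "y \<in> W" "i \<in> I" "j \<in> I" "E i y = E j y" "i \<noteq> j"
  then show False using orth_zero[of y i j] orth_square_nonzero[of y i] by simp
qed

lemma orth_independent:
  assumes "y \<in> W"
  shows "independent ((\<lambda>i. E i y) ` I)"
proof
  assume "dependent ((\<lambda>i. E i y) ` I)"
  then obtain i where i: "i \<in> I" "E i y \<in> span ((\<lambda>i. E i y) ` I - {E i y})"
    unfolding dependent_def by blast
  have "(\<lambda>i. E i y) ` I - {E i y} \<subseteq> (\<lambda>i. E i y) ` (I - {i})" by blast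
  then have "E i y \<in> span ((\<lambda>i. E i y) ` (I - {i}))" using i(2) span_mono by blast
  then obtain c where c: "E i y = (\<Sum>j\<in>I - {i}. c j *\<^sub>R E j y)"
    using span_image_eq_sum[of "I - {i}"] orth_finite by blast
  have "(\<Sum>j\<in>I - {i}. c j *\<^sub>R E j y) = (\<Sum>j\<in>I. (c(i := 0)) j *\<^sub>R E j y)"
    using orth_finite i(1) by (intro sum.mono_neutral_cong_left) auto
  with c orth_sum[OF assms i(1), of "c(i := 0)"] orth_square_nonzero[OF assms i(1)] show False by simp
qed

end

text \<open>Gram-Schmidt near a point. As long as there are fewer than \<open>r\<close> fields, some vector of \<open>T x\<close> lies
  outside their span. Extended to a section of \<open>T\<close> and made orthogonal to the previous fields it stays
  nonzero at \<open>x\<close>, hence near \<open>x\<close>. Once there are \<open>r\<close> fields they span \<open>T\<close> for dimension reasons.\<close>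

lemma distribution_orthogonal_frame:
  assumes T: "distribution A r T"
  obtains W and E :: "nat \<Rightarrow> 'm vfield" where "x \<in> W" "orthogonal_frame T W {..<r} E"
proof -
  have "\<exists>W (E :: nat \<Rightarrow> 'm vfield). x \<in> W \<and> orthogonal_fields W {..<k} E \<and>
      (\<forall>y\<in>W. \<forall>i<k. E i y \<in> T y)" if "k \<le> r" for k
    using that
  proof (induction k)
    case 0
    show ?case by (rule exI[of _ UNIV]) (simp add: orthogonal_fields_def)
  next
    case (Suc k)
    then obtain W E where E: "x \<in> W" "orthogonal_fields W {..<k} E" "\<forall>y\<in>W. \<forall>i<k. E i y \<in> T y"
      by auto
    have "\<not> T x \<subseteq> span ((\<lambda>i. E i x) ` {..<k})"
    proof
      assume "T x \<subseteq> span ((\<lambda>i. E i x) ` {..<k})"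
      then have "dim (T x) \<le> card ((\<lambda>i. E i x) ` {..<k})" by (rule dim_le_card) simp
      also have "\<dots> \<le> k" using card_image_le[of "{..<k}"] by simp
      finally show False using Suc.prems distribution_dim[OF T] by simp
    qed
    then obtain v where v: "v \<in> T x" "v \<notin> span ((\<lambda>i. E i x) ` {..<k})" by blast
    obtain W' V where V: "x \<in> W'" "vector_field_on A W' V" "V x = v" "\<And>y. y \<in> W' \<Longrightarrow> V y \<in> T y"
      using distribution_extend[OF T v(1)] by blast
    \<comment> \<open>its value at \<open>x\<close> is nonzero since \<open>v\<close> is outside the span\<close>
    define N where "N = (\<lambda>y. V y - projection {..<k} E y (V y))"
    have o: "open (W \<inter> W')" using orth_open[OF E(2)] vector_field_on_open[OF V(2)] by blast
    have V': "vector_field_on A (W \<inter> W') V" by (rule vector_field_on_subset[OF V(2) o]) simp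
    have N: "vector_field_on A (W \<inter> W') N"
      unfolding N_def by (rule vector_field_on_diff[OF V' projection_field[OF E(2) V']]) simp
    have "N x \<noteq> 0" using v(2) V(3) projection_in_span[of "{..<k}" E x v] unfolding N_def by auto
    then have "g x (N x) (N x) \<noteq> 0"
      using metric_pos[OF vector_field_on_tangent[OF N]] E(1) V(1) by force
    then obtain U where U: "open U" "x \<in> U" "U \<subseteq> W \<inter> W'" "\<And>y. y \<in> U \<Longrightarrow> g y (N y) (N y) \<noteq> 0"
      using smooth_function_nonzero_near[OF metric_smooth[OF N N], of x] E(1) V(1) by blast
    have zero: "g y 0 0 = 0" for y
      by (rule covector_zero[OF metric_covector[OF subspace_0[OF subspace_tangent_space]]])
    have NE: "g y (N y) (E i y) = 0" "g y (E i y) (N y) = 0" if "y \<in> U" "i < k" for y i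
    proof -
      have y: "y \<in> W" "y \<in> W \<inter> W'" using that U(3) by blast+
      have i: "i \<in> {..<k}" using that by simp
      show 1: "g y (N y) (E i y) = 0"
        unfolding N_def by (rule projection_residual[OF E(2) y(1) i vector_field_on_tangent[OF V' y(2)]])
      show "g y (E i y) (N y) = 0"
        using metric_sym[OF orth_tangent[OF E(2) y(1) i] vector_field_on_tangent[OF N y(2)]] 1 by simp
    qed
    have NT: "N y \<in> T y" if "y \<in> U" for y
    proof -
      have y: "y \<in> W" "y \<in> W'" using that U(3) by blast+
      have "(\<lambda>i. E i y) ` {..<k} \<subseteq> T y" using E(3) y(1) by auto
      then have "projection {..<k} E y (V y) \<in> T y"
        using span_minimal[OF _ distribution_subspace[OF T]] projection_in_span by blast
      then show ?thesis unfolding N_def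
        by (intro subspace_diff[OF distribution_subspace[OF T]] V(4)[OF y(2)])
    qed
    have "vector_field_on A U ((E(k := N)) i)" if "i < Suc k" for i
    proof (cases "i = k")
      case True
      then show ?thesis using vector_field_on_subset[OF N U(1,3)] by simp
    next
      case False
      then have i: "i \<in> {..<k}" using that by simp
      have "U \<subseteq> W" using U(3) by blast
      from vector_field_on_subset[OF orth_field[OF E(2) i] U(1) this] False show ?thesis by simp
    qed
    moreover have "(E(k := N)) i y \<noteq> 0" if "y \<in> U" "i < Suc k" for y i
    proof (cases "i = k")
      case True
      then show ?thesis using U(4)[OF that(1)] zero by auto
    next
      case False
      then show ?thesis using orth_nonzero[OF E(2), of y i] that U(3) by auto
    qed
    moreover have "g y ((E(k := N)) i y) ((E(k := N)) j y) = 0"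
      if "y \<in> U" "i < Suc k" "j < Suc k" "i \<noteq> j" for y i j
      using NE[OF that(1)] orth_zero[OF E(2), of y i j] that U(3)
      by (cases "i = k"; cases "j = k") auto
    ultimately have "orthogonal_fields U {..<Suc k} (E(k := N))"
      unfolding orthogonal_fields_def using U(1) by simp
    moreover have "\<forall>y\<in>U. \<forall>i<Suc k. (E(k := N)) i y \<in> T y"
      using NT E(3) U(3) by (auto simp: less_Suc_eq)
    ultimately show ?case using U(2) by blast
  qed
  then obtain W E where E: "x \<in> W" "orthogonal_fields W {..<r} E" "\<forall>y\<in>W. \<forall>i<r. E i y \<in> T y"
    by blast
  have "T y = span ((\<lambda>i. E i y) ` {..<r})" if y: "y \<in> W" for y
  proof
    show "span ((\<lambda>i. E i y) ` {..<r}) \<subseteq> T y"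
      by (rule span_minimal[OF _ distribution_subspace[OF T]]) (use E(3) y in auto)
    show "T y \<subseteq> span ((\<lambda>i. E i y) ` {..<r})"
    proof (rule subsetI, rule ccontr)
      let ?S = "(\<lambda>i. E i y) ` {..<r}"
      fix v assume v: "v \<in> T y" "v \<notin> span ?S"
      obtain W' F where F: "y \<in> W'" "\<And>z. z \<in> W' \<Longrightarrow> T z = span ((\<lambda>i. F i z) ` {..<r})"
        using distribution_fields[OF T, where x = y] by metis
      have "independent (insert v ?S)"
        by (rule independent_insertI[OF v(2) orth_independent[OF E(2) y]])
      moreover have "insert v ?S \<subseteq> span ((\<lambda>i. F i y) ` {..<r})"
        using v(1) E(3) y F by auto
      ultimately have "card (insert v ?S) \<le> card ((\<lambda>i. F i y) ` {..<r})"
        using independent_span_bound[of "(\<lambda>i. F i y) ` {..<r}"] by blast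
      also have "\<dots> \<le> r" using card_image_le[of "{..<r}"] by simp
      finally have "card (insert v ?S) \<le> r" .
      moreover have "v \<notin> ?S" using v(2) span_base[of v ?S] by (rule contrapos_nn)
      moreover have "card ?S = r" using card_image[OF orth_inj[OF E(2) y]] by (simp only: card_lessThan)
      ultimately show False by simp
    qed
  qed
  then have "orthogonal_frame T W {..<r} E" using E(2) unfolding orthogonal_frame_def by blast
  with E(1) show ?thesis by (rule that)
qed

lemma orthogonal_frame_subset:
  assumes "orthogonal_frame T W I E" "open V" "V \<subseteq> W"
  shows "orthogonal_frame T V I E"
proof -
  have o: "orthogonal_fields W I E" and T: "\<forall>y\<in>W. T y = span ((\<lambda>i. E i y) ` I)"
    using assms(1) by (simp_all add: orthogonal_frame_def)
  have "orthogonal_fields V I E"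
    unfolding orthogonal_fields_def
    using assms(2) orth_finite[OF o] vector_field_on_subset[OF orth_field[OF o] assms(2,3)]
      orth_nonzero[OF o] orth_zero[OF o] subsetD[OF assms(3)] by simp
  moreover have "\<forall>y\<in>V. T y = span ((\<lambda>i. E i y) ` I)" using T assms(3) by blast
  ultimately show ?thesis unfolding orthogonal_frame_def ..
qed

lemma orthogonal_frame_Plus:
  assumes 1: "orthogonal_frame T1 W I1 E1" and 2: "orthogonal_frame T2 W I2 E2"
    and split: "orthogonal_splitting A g T1 T2"
  shows "orthogonal_frame (tangent_space A) W (I1 <+> I2) (case_sum E1 E2)"
proof -
  have o: "orthogonal_fields W I1 E1" "orthogonal_fields W I2 E2"
    and T: "\<And>y. y \<in> W \<Longrightarrow> T1 y = span ((\<lambda>i. E1 i y) ` I1)" "\<And>y. y \<in> W \<Longrightarrow> T2 y = span ((\<lambda>i. E2 i y) ` I2)"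
    using 1 2 by (simp_all add: orthogonal_frame_def)
  have 12: "g y (E1 i y) (E2 j y) = 0" "g y (E2 j y) (E1 i y) = 0" if "y \<in> W" "i \<in> I1" "j \<in> I2" for y i j
  proof -
    have "E1 i y \<in> T1 y" "E2 j y \<in> T2 y" using that by (simp_all add: T span_base)
    then show *: "g y (E1 i y) (E2 j y) = 0" using split unfolding orthogonal_splitting_def by blast
    show "g y (E2 j y) (E1 i y) = 0"
      using metric_sym[OF orth_tangent[OF o(1) that(1,2)] orth_tangent[OF o(2) that(1,3)]] * by simp
  qed
  have "orthogonal_fields W (I1 <+> I2) (case_sum E1 E2)"
    unfolding orthogonal_fields_def
    using orth_open[OF o(1)] orth_finite[OF o(1)] orth_finite[OF o(2)]
      orth_field[OF o(1)] orth_field[OF o(2)] orth_nonzero[OF o(1)] orth_nonzero[OF o(2)]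
      orth_zero[OF o(1)] orth_zero[OF o(2)] 12
    by (simp add: Plus_def ball_Un)
  moreover have "tangent_space A y = span ((\<lambda>i. case_sum E1 E2 i y) ` (I1 <+> I2))" if "y \<in> W" for y
  proof -
    have "(\<lambda>i. case_sum E1 E2 i y) ` (I1 <+> I2) = (\<lambda>i. E1 i y) ` I1 \<union> (\<lambda>i. E2 i y) ` I2"
      by (simp add: Plus_def image_Un image_image)
    moreover have "tangent_space A y = {v + w | v w. v \<in> T1 y \<and> w \<in> T2 y}"
      by (rule split[unfolded orthogonal_splitting_def, THEN spec, THEN conjunct1])
    ultimately show ?thesis by (simp only: span_Un T[OF that])
  qed
  ultimately show ?thesis by (simp add: orthogonal_frame_def)
qed

context
  fixes T W and I :: "'i set" and E assumes frame: "orthogonal_frame T W I E"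
begin

lemma frame_orth: "orthogonal_fields W I E"
  and frame_span: "y \<in> W \<Longrightarrow> T y = span ((\<lambda>i. E i y) ` I)"
  using frame by (simp_all add: orthogonal_frame_def)

lemma frame_in: "y \<in> W \<Longrightarrow> i \<in> I \<Longrightarrow> E i y \<in> T y"
  by (simp add: frame_span span_base)

lemma frame_expansion: "y \<in> W \<Longrightarrow> v \<in> T y \<Longrightarrow> v = (\<Sum>i\<in>I. coordinate (E i) y v *\<^sub>R E i y)"
  using projection_eq[OF frame_orth] frame_span unfolding projection_def by simp

lemma frame_extend:
  assumes "x \<in> W" "v \<in> T x"
  obtains V where "vector_field_on A W V" "V x = v" "\<And>y. y \<in> W \<Longrightarrow> V y \<in> T y"
proof -
  have "v \<in> span ((\<lambda>i. E i x) ` I)" using assms frame_span by simp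
  then obtain V where "vector_field_on A W V" "V x = v" "\<And>y. V y \<in> span ((\<lambda>i. E i y) ` I)"
    using extend_in_span[of W I E v x, OF orth_open[OF frame_orth] orth_finite[OF frame_orth]
        orth_field[OF frame_orth]] by auto
  then show ?thesis using that frame_span by blast
qed

text \<open>The coordinates of \<open>X\<close> in the frame are smooth functions, so linearity over these reduces
  \<open>K X\<close> to the values of \<open>K\<close> on the frame. In particular \<open>K X\<close> depends on \<open>X\<close> only through \<open>X x\<close>. The
  version for sections of a subbundle \<open>T\<close> serves for traces over one factor of a splitting.\<close>

lemma tensorial_expansion:
  fixes K :: "'m vfield \<Rightarrow> 'v::real_vector"
  assumes x: "x \<in> W" and X: "vector_field_on A W X" and XT: "\<And>y. y \<in> W \<Longrightarrow> X y \<in> T y"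
    and add: "\<And>X Y. vector_field_on A W X \<Longrightarrow> vector_field_on A W Y \<Longrightarrow>
      K (\<lambda>y. X y + Y y) = K X + K Y"
    and scale: "\<And>f X. smooth_function_on A W f \<Longrightarrow> vector_field_on A W X \<Longrightarrow>
      K (\<lambda>y. f y *\<^sub>R X y) = f x *\<^sub>R K X"
    and cong: "\<And>X Y. vector_field_on A W X \<Longrightarrow> (\<And>y. y \<in> W \<Longrightarrow> X y = Y y) \<Longrightarrow> K X = K Y"
  shows "K X = (\<Sum>i\<in>I. coordinate (E i) x (X x) *\<^sub>R K (E i))"
proof -
  have W: "open W" by (rule orth_open[OF frame_orth])
  have zero: "K (\<lambda>y. 0) = 0"
    using scale[OF smooth_function_on_const[OF W, of 0] vector_field_on_zero[OF W]] by simp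
  have coeff: "smooth_function_on A W (\<lambda>y. coordinate (E i) y (X y))" if "i \<in> I" for i
    by (rule coordinate_smooth[OF frame_orth X order_refl that])
  have "K (\<lambda>y. \<Sum>i\<in>J. coordinate (E i) y (X y) *\<^sub>R E i y) = (\<Sum>i\<in>J. coordinate (E i) x (X x) *\<^sub>R K (E i))"
    if "finite J" "J \<subseteq> I" for J
    using that
  proof (induction J)
    case (insert i J)
    have i: "vector_field_on A W (\<lambda>y. coordinate (E i) y (X y) *\<^sub>R E i y)"
      using insert.prems by (intro vector_field_on_scale coeff orth_field[OF frame_orth]) auto
    have J: "vector_field_on A W (\<lambda>y. \<Sum>i\<in>J. coordinate (E i) y (X y) *\<^sub>R E i y)"
      using insert.prems by (intro vector_field_on_sum[OF W] vector_field_on_scale coeff orth_field[OF frame_orth]) auto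
    have Ei: "i \<in> I" using insert.prems by simp
    show ?case
      using add[OF i J] scale[OF coeff[OF Ei] orth_field[OF frame_orth Ei]] insert.IH insert.prems
      by (simp only: sum.insert[OF insert.hyps] insert_subset simp_thms)
  qed (simp add: zero)
  from this[OF orth_finite[OF frame_orth] order_refl]
  show ?thesis using cong[OF X frame_expansion[OF _ XT]] by simp
qed

end

text \<open>In an orthogonal frame the Riesz representative of \<open>\<theta>\<close> has the coordinates
  \<open>\<theta>(E\<^sub>i) / g(E\<^sub>i, E\<^sub>i)\<close>.\<close>

lemma metric_sharp:
  assumes frame: "orthogonal_frame (tangent_space A) W I E" and x: "x \<in> W"
    and \<theta>: "covector A x (\<theta> x)"
  shows "sharp A g \<theta> x \<in> tangent_space A x"
    and "\<And>w. w \<in> tangent_space A x \<Longrightarrow> g x (sharp A g \<theta> x) w = \<theta> x w"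
proof -
  note o = frame_orth[OF frame]
  note t = orth_tangent[OF o x]
  define s where "s = (\<Sum>i\<in>I. (\<theta> x (E i x) / g x (E i x) (E i x)) *\<^sub>R E i x)"
  have s: "s \<in> tangent_space A x"
    unfolding s_def by (intro subspace_sum[OF subspace_tangent_space] subspace_scale[OF subspace_tangent_space] t)
  have sw: "g x s w = \<theta> x w" if w: "w \<in> tangent_space A x" for w
  proof -
    have "\<theta> x w = \<theta> x (\<Sum>i\<in>I. coordinate (E i) x w *\<^sub>R E i x)"
      using frame_expansion[OF frame x w] by simp
    also have "\<dots> = (\<Sum>i\<in>I. \<theta> x (coordinate (E i) x w *\<^sub>R E i x))"
      by (rule covector_sum[OF \<theta>]) (intro subspace_scale[OF subspace_tangent_space] t)
    also have "\<dots> = (\<Sum>i\<in>I. (\<theta> x (E i x) / g x (E i x) (E i x)) * g x (E i x) w)"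
      by (intro sum.cong refl) (simp add: covector_scale[OF \<theta>] t coordinate_def metric_sym[OF w t])
    also have "\<dots> = (\<Sum>i\<in>I. g x ((\<theta> x (E i x) / g x (E i x) (E i x)) *\<^sub>R E i x) w)"
      by (intro sum.cong refl) (simp add: covector_scale[OF metric_covector_left[OF w]] t)
    also have "\<dots> = g x s w" unfolding s_def
      by (rule covector_sum[OF metric_covector_left[OF w], symmetric])
        (intro subspace_scale[OF subspace_tangent_space] t)
    finally show ?thesis by simp
  qed
  have "sharp A g \<theta> x = s"
    unfolding sharp_def
  proof (rule the_equality)
    fix v assume v: "v \<in> tangent_space A x \<and> (\<forall>w\<in>tangent_space A x. g x v w = \<theta> x w)"
    have d: "v - s \<in> tangent_space A x" using v s by (intro subspace_diff[OF subspace_tangent_space]) auto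
    have "g x (v - s) (v - s) = g x v (v - s) - g x s (v - s)"
      using v s by (intro covector_diff[OF metric_covector_left[OF d]]) auto
    then have "g x (v - s) (v - s) = 0" using v sw d by simp
    then show "v = s" using metric_pos[OF d] by force
  qed (use s sw in blast)
  then show "sharp A g \<theta> x \<in> tangent_space A x"
    and "\<And>w. w \<in> tangent_space A x \<Longrightarrow> g x (sharp A g \<theta> x) w = \<theta> x w" using s sw by auto
qed

end

section \<open>The curvature tensor and the Ricci tensor\<close>

locale riemannian_connection = riemannian_manifold A g + torsion_free_connection A D
  for A :: "('m::{t2_space, second_countable_topology}, 'e::euclidean_space) chart set"
    and g :: "'m metric" and D :: "'m conn"
begin

context
  fixes W and I :: "'i set" and E assumes frame: "orthogonal_frame (tangent_space A) W I E"
begin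

lemma curvature_cong_first:
  assumes "vector_field_on A W X" "vector_field_on A W X'" "vector_field_on A W Y" "vector_field_on A W Z"
    "x \<in> W" "X x = X' x"
  shows "curvature A D X Y Z x = curvature A D X' Y Z x"
proof -
  have "curvature A D X Y Z x = (\<Sum>i\<in>I. coordinate (E i) x (X x) *\<^sub>R curvature A D (E i) Y Z x)"
    if "vector_field_on A W X" for X
    by (rule tensorial_expansion[OF frame assms(5) that vector_field_on_tangent[OF that],
          where K = "\<lambda>X. curvature A D X Y Z x"])
      (blast intro: curvature_add_first curvature_scale_first assms
        curvature_cong[OF _ assms(3-5) _ refl refl])+
  from this[OF assms(1)] this[OF assms(2)] assms(6) show ?thesis by simp
qed

lemma curvature_cong_third:
  assumes "vector_field_on A W X" "vector_field_on A W Y" "vector_field_on A W Z" "vector_field_on A W Z'"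
    "x \<in> W" "Z x = Z' x"
  shows "curvature A D X Y Z x = curvature A D X Y Z' x"
proof -
  have "curvature A D X Y Z x = (\<Sum>i\<in>I. coordinate (E i) x (Z x) *\<^sub>R curvature A D X Y (E i) x)"
    if "vector_field_on A W Z" for Z
    by (rule tensorial_expansion[OF frame assms(5) that vector_field_on_tangent[OF that],
          where K = "\<lambda>Z. curvature A D X Y Z x"])
      (blast intro: curvature_add_third curvature_scale_third assms
        curvature_cong[OF assms(1,2) _ assms(5) refl refl])+
  from this[OF assms(3)] this[OF assms(4)] assms(6) show ?thesis by simp
qed

end

text \<open>The description in \<^const>\<open>curvature_at\<close> has a unique solution by tensoriality in each argument. The
  second argument is reduced to the first by skew symmetry.\<close>

lemma curvature_at_eq:
  assumes frame: "orthogonal_frame (tangent_space A) W I E" and x: "x \<in> W"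
    and X: "vector_field_on A W X" and Y: "vector_field_on A W Y" and Z: "vector_field_on A W Z"
  shows "curvature_at A D x (X x) (Y x) (Z x) = curvature A D X Y Z x"
  unfolding curvature_at_def
proof (rule the_equality)
  show "\<forall>W' X' Y' Z'. x \<in> W' \<and> vector_field_on A W' X' \<and> vector_field_on A W' Y' \<and>
    vector_field_on A W' Z' \<and> X' x = X x \<and> Y' x = Y x \<and> Z' x = Z x \<longrightarrow>
    curvature A D X' Y' Z' x = curvature A D X Y Z x"
  proof (intro allI impI, elim conjE)
    fix W' X' Y' Z'
    assume x': "x \<in> W'" and f': "vector_field_on A W' X'" "vector_field_on A W' Y'" "vector_field_on A W' Z'"
      and eq: "X' x = X x" "Y' x = Y x" "Z' x = Z x"
    define V where "V = W \<inter> W'"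
    have V: "open V" "V \<subseteq> W" "V \<subseteq> W'" "x \<in> V"
      using vector_field_on_open[OF X] vector_field_on_open[OF f'(1)] x x' unfolding V_def by auto
    note fr = orthogonal_frame_subset[OF frame V(1,2)]
    note r = vector_field_on_subset[OF X V(1,2)] vector_field_on_subset[OF Y V(1,2)]
      vector_field_on_subset[OF Z V(1,2)]
    note r' = vector_field_on_subset[OF f'(1) V(1,3)] vector_field_on_subset[OF f'(2) V(1,3)]
      vector_field_on_subset[OF f'(3) V(1,3)]
    have "curvature A D X' Y' Z' x = curvature A D X Y' Z' x"
      by (rule curvature_cong_first[OF fr r'(1) r(1) r'(2,3) V(4) eq(1)])
    also have "\<dots> = - curvature A D Y' X Z' x"
      by (rule curvature_swap[OF r(1) r'(2,3) V(4)])
    also have "curvature A D Y' X Z' x = curvature A D Y X Z' x"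
      by (rule curvature_cong_first[OF fr r'(2) r(2) r(1) r'(3) V(4) eq(2)])
    also have "- curvature A D Y X Z' x = curvature A D X Y Z' x"
      by (rule curvature_swap[OF r(1,2) r'(3) V(4), symmetric])
    also have "\<dots> = curvature A D X Y Z x"
      by (rule curvature_cong_third[OF fr r(1,2) r'(3) r(3) V(4) eq(3)])
    finally show "curvature A D X' Y' Z' x = curvature A D X Y Z x" .
  qed
qed (use x X Y Z in blast)

lemma ricci_eq_sum:
  assumes frame: "orthogonal_frame (tangent_space A) W I E" and x: "x \<in> W"
    and X: "vector_field_on A W X" and Y: "vector_field_on A W Y"
  shows "ricci A D x (X x) (Y x) = (\<Sum>i\<in>I. coordinate (E i) x (curvature A D (E i) X Y x))"
proof -
  note o = frame_orth[OF frame]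
  define L where "L = (\<lambda>u. curvature_at A D x u (X x) (Y x))"
  have L: "L (U x) = curvature A D U X Y x" if "vector_field_on A W U" for U
    unfolding L_def by (rule curvature_at_eq[OF frame x that X Y])
  have "trace_on (tangent_space A x) L = (\<Sum>i\<in>I. coordinate (E i) x (L (E i x)))"
  proof (rule trace_on_eq_sum_coordinates[OF subspace_tangent_space orth_finite[OF o]])
    fix u v assume uv: "u \<in> tangent_space A x" "v \<in> tangent_space A x"
    obtain U where U: "vector_field_on A W U" "U x = u" using frame_extend[OF frame x uv(1)] by blast
    obtain V where V: "vector_field_on A W V" "V x = v" using frame_extend[OF frame x uv(2)] by blast
    show "L (u + v) = L u + L v"
      using L[OF vector_field_on_add[OF U(1) V(1)]] L[OF U(1)] L[OF V(1)] U(2) V(2)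
        curvature_add_first[OF U(1) V(1) X Y x] by simp
  next
    fix r v assume v: "v \<in> tangent_space A x"
    obtain V where V: "vector_field_on A W V" "V x = v" using frame_extend[OF frame x v] by blast
    have c: "smooth_function_on A W (\<lambda>y. r)" by (rule smooth_function_on_const[OF orth_open[OF o]])
    show "L (r *\<^sub>R v) = r *\<^sub>R L v"
      using L[OF vector_field_on_scale[OF c V(1)]] L[OF V(1)] V(2) curvature_scale_first[OF c V(1) X Y x]
      by simp
  next
    fix v assume v: "v \<in> tangent_space A x"
    obtain V where V: "vector_field_on A W V" "V x = v" using frame_extend[OF frame x v] by blast
    show "L v \<in> tangent_space A x"
      using vector_field_on_tangent[OF curvature_field[OF V(1) X Y] x] L[OF V(1)] V(2) by simp
  qed (rule orth_tangent[OF o x] frame_expansion[OF frame x] coordinate_add[where E = "E _"]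
      coordinate_scale[where E = "E _"]; (rule orth_tangent[OF o x])?; assumption)+
  then show ?thesis
    unfolding ricci_def L_def[symmetric] using L[OF orth_field[OF o]] by simp
qed

end

section \<open>Weyl structures\<close>

text \<open>The covariant derivative \<open>(D\<^sub>X \<theta>)(Y)\<close>.\<close>

definition form_derivative :: "'m conn \<Rightarrow> 'm form1 \<Rightarrow> 'm vfield \<Rightarrow> 'm vfield \<Rightarrow> 'm \<Rightarrow> real" where
  "form_derivative D \<theta> X Y x = X x (\<lambda>y. \<theta> y (Y y)) - \<theta> x (D X Y x)"

text \<open>The compatibility condition is \<open>D g = - 2 \<theta> \<otimes> g\<close>. A Levi-Civita connection is the instance
  \<open>\<theta> = 0\<close>, so that curvature identities for it and for Weyl connections are proved at once.\<close>

locale weyl_structure = riemannian_manifold A g + torsion_free_connection A D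
  for A :: "('m::{t2_space, second_countable_topology}, 'e::euclidean_space) chart set"
    and g :: "'m metric" and D :: "'m conn" +
  fixes \<theta> :: "'m form1"
  assumes lee_form: "one_form A \<theta>"
    and weyl_compatible: "vector_field_on A W X \<Longrightarrow> vector_field_on A W Y \<Longrightarrow> vector_field_on A W Z \<Longrightarrow>
      x \<in> W \<Longrightarrow> X x (\<lambda>y. g y (Y y) (Z y)) =
        g x (D X Y x) (Z x) + g x (Y x) (D X Z x) - 2 * \<theta> x (X x) * g x (Y x) (Z x)"
begin

lemma ext_deriv_eq_form_derivative:
  assumes "vector_field_on A W X" "vector_field_on A W Y" "x \<in> W"
  shows "ext_deriv A \<theta> X Y x = form_derivative D \<theta> X Y x - form_derivative D \<theta> Y X x"
  using covector_diff[OF one_form_covector[OF lee_form]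
      vector_field_on_tangent[OF conn_field[OF assms(1,2)] assms(3)]
      vector_field_on_tangent[OF conn_field[OF assms(2,1)] assms(3)]]
    torsion_free[OF assms]
  by (simp add: ext_deriv_def form_derivative_def)

text \<open>Differentiate \<open>g(V, V)\<close> along \<open>X\<close>, \<open>Y\<close> in both orders and along \<open>[X, Y]\<close>. In
  \<open>[X, Y] - XY + YX = 0\<close> the mixed first-order terms are symmetric in \<open>X\<close> and \<open>Y\<close> and cancel. For
  \<open>\<theta> = 0\<close> this is the skew symmetry of the Riemann tensor in its last two arguments.\<close>

lemma curvature_symmetric_part:
  assumes X: "vector_field_on A W X" and Y: "vector_field_on A W Y" and V: "vector_field_on A W V"
    and x: "x \<in> W"
  shows "g x (curvature A D X Y V x) (V x) = ext_deriv A \<theta> X Y x * g x (V x) (V x)"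
proof -
  define G where "G = (\<lambda>y. g y (V y) (V y))"
  note t = vector_field_on_tangent
  have G: "smooth_function_on A W G" unfolding G_def by (rule metric_smooth[OF V V])
  have first: "P y G = 2 * g y (D P V y) (V y) - 2 * (\<theta> y (P y) * G y)"
    if P: "vector_field_on A W P" and y: "y \<in> W" for P y
    using weyl_compatible[OF P V V y] metric_sym[OF t[OF V y] t[OF conn_field[OF P V] y]]
    unfolding G_def by simp
  have second: "P x (\<lambda>y. Q y G) = 2 * (g x (D P (D Q V) x) (V x) + g x (D Q V x) (D P V x)
        - 2 * \<theta> x (P x) * g x (D Q V x) (V x))
      - 2 * (P x (\<lambda>y. \<theta> y (Q y)) * G x
        + \<theta> x (Q x) * (2 * g x (D P V x) (V x) - 2 * (\<theta> x (P x) * G x)))"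
    if P: "vector_field_on A W P" and Q: "vector_field_on A W Q" for P Q
  proof -
    have Px: "P x \<in> tangent_space A x" by (rule t[OF P x])
    have s1: "smooth_near A x (\<lambda>y. g y (D Q V y) (V y))"
      by (rule smooth_near_I[OF metric_smooth[OF conn_field[OF Q V] V] x])
    have s2: "smooth_near A x (\<lambda>y. \<theta> y (Q y))"
      by (rule smooth_near_I[OF one_form_smooth[OF lee_form Q] x])
    have s3: "smooth_near A x G" by (rule smooth_near_I[OF G x])
    have s4: "smooth_near A x (\<lambda>y. \<theta> y (Q y) * G y)" by (rule smooth_near_arith(2)[OF s2 s3])
    have c: "smooth_near A x f \<Longrightarrow> smooth_near A x (\<lambda>y. 2 * f y)" for f
      using smooth_near_arith(1)[of x f f] by simp
    have "P x (\<lambda>y. Q y G) = P x (\<lambda>y. 2 * g y (D Q V y) (V y) - 2 * (\<theta> y (Q y) * G y))"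
      by (rule tangent_cong[OF Px vector_field_on_open[OF P] x first[OF Q]])
    also have "\<dots> = P x (\<lambda>y. 2 * g y (D Q V y) (V y)) - P x (\<lambda>y. 2 * (\<theta> y (Q y) * G y))"
      by (rule tangent_diff[OF Px c[OF s1] c[OF s4]])
    also have "\<dots> = 2 * P x (\<lambda>y. g y (D Q V y) (V y)) - 2 * P x (\<lambda>y. \<theta> y (Q y) * G y)"
      by (simp only: tangent_cmult[OF Px s1] tangent_cmult[OF Px s4])
    also have "P x (\<lambda>y. \<theta> y (Q y) * G y) = P x (\<lambda>y. \<theta> y (Q y)) * G x + \<theta> x (Q x) * P x G"
      by (rule tangent_mult[OF Px s2 s3])
    also note first[OF P x]
    also note weyl_compatible[OF P conn_field[OF Q V] V x]
    finally show ?thesis .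
  qed
  have b: "lie_bracket A X Y x G = X x (\<lambda>y. Y y G) - Y x (\<lambda>y. X y G)"
    using smooth_near_I[OF G x] by (simp add: lie_bracket_def)
  have sym: "g x (D Y V x) (D X V x) = g x (D X V x) (D Y V x)"
    by (rule metric_sym[OF t[OF conn_field[OF Y V] x] t[OF conn_field[OF X V] x]])
  note cv = metric_covector_left[OF t[OF V x]]
  have c1: "D X (D Y V) x \<in> tangent_space A x" "D Y (D X V) x \<in> tangent_space A x"
    "D (lie_bracket A X Y) V x \<in> tangent_space A x"
    by (rule t[OF _ x], intro conn_field lie_bracket_field X Y V)+
  have "g x (curvature A D X Y V x) (V x) =
      g x (D X (D Y V) x) (V x) - g x (D Y (D X V) x) (V x) - g x (D (lie_bracket A X Y) V x) (V x)"
    unfolding curvature_def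
    by (simp only: covector_diff[OF cv subspace_diff[OF subspace_tangent_space c1(1,2)] c1(3)]
        covector_diff[OF cv c1(1,2)])
  then show ?thesis
    using first[OF lie_bracket_field[OF X Y] x] b second[OF X Y] second[OF Y X] sym
    unfolding ext_deriv_def G_def by (simp add: algebra_simps)
qed

end

section \<open>Conformal product structures\<close>

text \<open>By lemma \<open>curvature_orthogonal\<close> below, this tensor and \<open>d\<theta>\<close> account for the difference between
  the curvatures of \<open>\<nabla>\<close> and \<open>D\<close> on suitably orthogonal arguments.\<close>

definition curvature_defect :: "'m conn \<Rightarrow> 'm form1 \<Rightarrow> 'm vfield \<Rightarrow> 'm vfield \<Rightarrow> 'm \<Rightarrow> real" where
  "curvature_defect D \<theta> X Y x = form_derivative D \<theta> X Y x + \<theta> x (X x) * \<theta> x (Y x)"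

locale conformal_product = riemannian_manifold A g
  for A :: "('m::{t2_space, second_countable_topology}, 'e::euclidean_space) chart set"
    and g :: "'m metric" +
  fixes nab D :: "'m conn" and p q :: nat and T1 T2 :: "'m \<Rightarrow> 'm tvec set" and \<theta> :: "'m form1"
  assumes levi_civita: "levi_civita A g nab"
    and product: "conformal_product_structure A g nab p q T1 T2 \<theta> D"
begin

lemma distributions: "distribution A p T1" "distribution A q T2"
  and splitting: "orthogonal_splitting A g T1 T2"
  and weyl: "weyl_connection A g nab \<theta> D"
  and preserves: "preserves A D T1" "preserves A D T2"
  using product by (simp_all add: conformal_product_structure_def)

lemma lee: "one_form A \<theta>"
  and weyl_is_connection: "is_connection A D"
  using weyl by (simp_all add: weyl_connection_def)

lemma tangent_split: "tangent_space A x = {v + w | v w. v \<in> T1 x \<and> w \<in> T2 x}"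
  and orthogonal: "v \<in> T1 x \<Longrightarrow> w \<in> T2 x \<Longrightarrow> g x v w = 0"
  and disjoint: "T1 x \<inter> T2 x = {0}"
  using splitting[unfolded orthogonal_splitting_def, THEN spec, of x] by (elim conjE; blast)+

lemma T_tangent: "v \<in> T1 x \<Longrightarrow> v \<in> tangent_space A x" "v \<in> T2 x \<Longrightarrow> v \<in> tangent_space A x"
  using distribution_tangent[OF distributions(1)] distribution_tangent[OF distributions(2)] by blast+

lemma orthogonal': "v \<in> T1 x \<Longrightarrow> w \<in> T2 x \<Longrightarrow> g x w v = 0"
  using orthogonal metric_sym T_tangent by metis

text \<open>Statements about \<open>T1\<close> become statements about \<open>T2\<close> through this symmetry.\<close>

lemma swapped_factors: "conformal_product A g nab D q p T2 T1 \<theta>"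
proof -
  have "orthogonal_splitting A g T2 T1"
    unfolding orthogonal_splitting_def
  proof (intro allI conjI ballI)
    fix x
    show "tangent_space A x = {v + w |v w. v \<in> T2 x \<and> w \<in> T1 x}"
      unfolding tangent_split using add.commute by blast
    show "T2 x \<inter> T1 x = {0}" using disjoint[of x] by (simp only: Int_commute)
    fix v w assume "v \<in> T2 x" "w \<in> T1 x"
    then show "g x v w = 0" by (rule orthogonal'[rotated])
  qed
  with distributions weyl preserves have "conformal_product_structure A g nab q p T2 T1 \<theta> D"
    by (simp add: conformal_product_structure_def)
  with levi_civita show ?thesis
    by (intro conformal_product.intro conformal_product_axioms.intro riemannian_manifold_axioms)
qed

lemma tangent_frame_near:
  assumes "open W" "x \<in> W"
  obtains V E1 E2 where "x \<in> V" "V \<subseteq> W" "open V"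
    "orthogonal_frame T1 V {..<p} E1" "orthogonal_frame T2 V {..<q} E2"
    "orthogonal_frame (tangent_space A) V ({..<p} <+> {..<q}) (case_sum E1 E2)"
proof -
  obtain V1 E1 where 1: "x \<in> V1" "orthogonal_frame T1 V1 {..<p} E1"
    by (rule distribution_orthogonal_frame[OF distributions(1)])
  obtain V2 E2 where 2: "x \<in> V2" "orthogonal_frame T2 V2 {..<q} E2"
    by (rule distribution_orthogonal_frame[OF distributions(2)])
  have V: "open (V1 \<inter> V2 \<inter> W)"
    using orth_open[OF frame_orth[OF 1(2)]] orth_open[OF frame_orth[OF 2(2)]] assms(1) by (intro open_Int)
  have fr: "orthogonal_frame T1 (V1 \<inter> V2 \<inter> W) {..<p} E1" "orthogonal_frame T2 (V1 \<inter> V2 \<inter> W) {..<q} E2"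
    by (rule orthogonal_frame_subset[OF 1(2) V], blast) (rule orthogonal_frame_subset[OF 2(2) V], blast)
  show ?thesis
    by (rule that[OF _ _ V fr orthogonal_frame_Plus[OF fr splitting]]) (use 1 2 assms in auto)
qed

lemma nab_torsion_free:
  "vector_field_on A W X \<Longrightarrow> vector_field_on A W Y \<Longrightarrow> x \<in> W \<Longrightarrow>
    nab X Y x - nab Y X x = lie_bracket A X Y x"
  by (rule levi_civita[unfolded levi_civita_def, THEN conjunct2, THEN conjunct1, rule_format]) simp_all

lemma nab_metric:
  "vector_field_on A W X \<Longrightarrow> vector_field_on A W Y \<Longrightarrow> vector_field_on A W Z \<Longrightarrow> x \<in> W \<Longrightarrow>
    X x (\<lambda>y. g y (Y y) (Z y)) = g x (nab X Y x) (Z x) + g x (Y x) (nab X Z x)"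
  by (rule levi_civita[unfolded levi_civita_def, THEN conjunct2, THEN conjunct2, rule_format]) simp_all

lemma D_eq:
  "vector_field_on A W X \<Longrightarrow> vector_field_on A W Y \<Longrightarrow> x \<in> W \<Longrightarrow>
    D X Y x = nab X Y x + \<theta> x (Y x) *\<^sub>R X x + \<theta> x (X x) *\<^sub>R Y x - g x (X x) (Y x) *\<^sub>R sharp A g \<theta> x"
  by (rule weyl[unfolded weyl_connection_def, THEN conjunct2, THEN conjunct2, rule_format]) simp_all

sublocale lc: weyl_structure A g nab "\<lambda>_ _. 0"
proof
  show "is_connection A nab" using levi_civita by (simp add: levi_civita_def)
  show "one_form A (\<lambda>_ _. 0)"
    by (simp add: one_form_def covector_def smooth_function_on_const vector_field_on_open)
qed (simp_all add: nab_torsion_free nab_metric)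

lemma metric_sharp_lee:
  shows "sharp A g \<theta> x \<in> tangent_space A x"
    and "w \<in> tangent_space A x \<Longrightarrow> g x (sharp A g \<theta> x) w = \<theta> x w"
proof -
  obtain V E1 E2 where V: "x \<in> V"
    "orthogonal_frame (tangent_space A) V ({..<p} <+> {..<q}) (case_sum E1 E2)"
    by (rule tangent_frame_near[OF open_UNIV UNIV_I])
  show "sharp A g \<theta> x \<in> tangent_space A x"
    and "w \<in> tangent_space A x \<Longrightarrow> g x (sharp A g \<theta> x) w = \<theta> x w"
    by (rule metric_sharp[OF V(2,1), of \<theta>, OF one_form_covector[OF lee]]; assumption)+
qed

lemma metric_D:
  assumes X: "vector_field_on A W X" and Y: "vector_field_on A W Y" and x: "x \<in> W"
    and w: "w \<in> tangent_space A x"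
  shows "g x (D X Y x) w = g x (nab X Y x) w + \<theta> x (Y x) * g x (X x) w + \<theta> x (X x) * g x (Y x) w
    - g x (X x) (Y x) * \<theta> x w"
proof -
  note cv = metric_covector_left[OF w]
  note t = vector_field_on_tangent[OF X x] vector_field_on_tangent[OF Y x]
    vector_field_on_tangent[OF lc.conn_field[OF X Y] x] metric_sharp_lee(1)[of x]
  note sub = subspace_add[OF subspace_tangent_space] subspace_scale[OF subspace_tangent_space]
  show ?thesis
    unfolding D_eq[OF X Y x]
    by (simp only: covector_diff[OF cv] covector_add[OF cv] covector_scale[OF cv] t sub metric_sharp_lee(2)[OF w])
qed

sublocale adapted: weyl_structure A g D \<theta>
proof
  show "is_connection A D" by (rule weyl_is_connection)
  show "one_form A \<theta>" by (rule lee)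
  fix W X Y x assume f: "vector_field_on A W X" "vector_field_on A W Y" "x \<in> W"
  show "D X Y x - D Y X x = lie_bracket A X Y x"
    using nab_torsion_free[OF f] metric_sym[OF vector_field_on_tangent[OF f(1,3)] vector_field_on_tangent[OF f(2,3)]]
    unfolding D_eq[OF f] D_eq[OF f(2,1,3)] by (simp add: algebra_simps)
next
  fix W X Y Z x assume f: "vector_field_on A W X" "vector_field_on A W Y" "vector_field_on A W Z" "x \<in> W"
  have D: "is_connection A D" by (rule weyl_is_connection)
  note t = vector_field_on_tangent[OF f(1,4)] vector_field_on_tangent[OF f(2,4)] vector_field_on_tangent[OF f(3,4)]
  have DXZ: "D X Z x \<in> tangent_space A x"
    by (rule vector_field_on_tangent[OF connection.conn_field[OF connection.intro[OF smooth_manifold_axioms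
          connection_axioms.intro[OF D]] f(1,3)] f(4)])
  have "g x (Y x) (D X Z x) = g x (D X Z x) (Y x)" by (rule metric_sym[OF t(2) DXZ])
  moreover have "g x (nab X Z x) (Y x) = g x (Y x) (nab X Z x)"
    by (rule metric_sym[OF vector_field_on_tangent[OF lc.conn_field[OF f(1,3)] f(4)] t(2)])
  ultimately show "X x (\<lambda>y. g y (Y y) (Z y)) =
        g x (D X Y x) (Z x) + g x (Y x) (D X Z x) - 2 * \<theta> x (X x) * g x (Y x) (Z x)"
    using nab_metric[OF f] metric_sym[OF t(2,3)]
    by (simp add: metric_D[OF f(1,2,4) t(3)] metric_D[OF f(1,3,4) t(2)])
qed

lemma nab_orthogonal:
  assumes "vector_field_on A W X" "vector_field_on A W Y" "x \<in> W" "g x (X x) (Y x) = 0"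
  shows "nab X Y x = D X Y x - \<theta> x (Y x) *\<^sub>R X x - \<theta> x (X x) *\<^sub>R Y x"
  using assms(4) unfolding D_eq[OF assms(1-3)] by simp

text \<open>The orthogonality assumptions say that each covariant derivative entering \<open>R(E, X)Y\<close> is taken of a
  pair of orthogonal fields, except for \<open>\<nabla>\<^sub>E X\<close> and \<open>\<nabla>\<^sub>X E\<close>. These occur only through
  \<open>\<nabla>\<^sub>E X - \<nabla>\<^sub>X E = [E, X]\<close>. So \<open>\<theta>\<^sup>\<sharp>\<close> never appears. In a conformal product they hold for
  \<open>E\<close>, \<open>X\<close> in one factor and \<open>Y\<close> in the other one.\<close>

lemma curvature_orthogonal:
  assumes E: "vector_field_on A W E" and X: "vector_field_on A W X" and Y: "vector_field_on A W Y"
    and x: "x \<in> W"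
    and EY: "\<And>y. y \<in> W \<Longrightarrow> g y (E y) (Y y) = 0" and XY: "\<And>y. y \<in> W \<Longrightarrow> g y (X y) (Y y) = 0"
    and EDXY: "g x (E x) (D X Y x) = 0" and XDEY: "g x (X x) (D E Y x) = 0"
    and EXY: "g x (lie_bracket A E X x) (Y x) = 0"
  shows "curvature A nab E X Y x = curvature A D E X Y x + curvature_defect D \<theta> X Y x *\<^sub>R E x
    - curvature_defect D \<theta> E Y x *\<^sub>R X x - ext_deriv A \<theta> E X x *\<^sub>R Y x"
proof -
  have second: "nab P (nab Q Y) x = D P (D Q Y) x - \<theta> x (D Q Y x) *\<^sub>R P x - \<theta> x (P x) *\<^sub>R D Q Y x
      - P x (\<lambda>y. \<theta> y (Y y)) *\<^sub>R Q x - \<theta> x (Y x) *\<^sub>R nab P Q x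
      - P x (\<lambda>y. \<theta> y (Q y)) *\<^sub>R Y x - \<theta> x (Q x) *\<^sub>R D P Y x
      + (\<theta> x (Q x) * \<theta> x (Y x)) *\<^sub>R P x + (\<theta> x (Q x) * \<theta> x (P x)) *\<^sub>R Y x"
    if P: "vector_field_on A W P" and Q: "vector_field_on A W Q"
      and PY: "g x (P x) (Y x) = 0" and QY: "\<And>y. y \<in> W \<Longrightarrow> g y (Q y) (Y y) = 0"
      and PDQY: "g x (P x) (D Q Y x) = 0" for P Q
  proof -
    have tY: "smooth_function_on A W (\<lambda>y. \<theta> y (Y y))" and tQ: "smooth_function_on A W (\<lambda>y. \<theta> y (Q y))"
      by (rule one_form_smooth[OF lee Y], rule one_form_smooth[OF lee Q])
    note DQY = adapted.conn_field[OF Q Y]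
    note fQ = vector_field_on_scale[OF tY Q]
    note fY = vector_field_on_scale[OF tQ Y]
    have "nab P (nab Q Y) x = nab P (\<lambda>y. D Q Y y - \<theta> y (Y y) *\<^sub>R Q y - \<theta> y (Q y) *\<^sub>R Y y) x"
      by (rule lc.conn_cong[OF P lc.conn_field[OF Q Y] x refl nab_orthogonal[OF Q Y _ QY]])
    also have "\<dots> = nab P (D Q Y) x - nab P (\<lambda>y. \<theta> y (Y y) *\<^sub>R Q y) x - nab P (\<lambda>y. \<theta> y (Q y) *\<^sub>R Y y) x"
      unfolding lc.conn_diff_right[OF P vector_field_on_diff[OF DQY fQ] fY x]
        lc.conn_diff_right[OF P DQY fQ x] ..
    finally show ?thesis
      unfolding lc.conn_scale_right[OF tY P Q x] lc.conn_scale_right[OF tQ P Y x]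
        nab_orthogonal[OF P Y x PY] nab_orthogonal[OF P DQY x PDQY]
      by (simp only: scaleR_diff_right scaleR_scaleR algebra_simps)
  qed
  have br: "nab (lie_bracket A E X) Y x = D (lie_bracket A E X) Y x
      - \<theta> x (Y x) *\<^sub>R (nab E X x - nab X E x) - \<theta> x (lie_bracket A E X x) *\<^sub>R Y x"
    unfolding nab_torsion_free[OF E X x]
    by (rule nab_orthogonal[OF lc.lie_bracket_field[OF E X] Y x EXY])
  have EX: "nab E (nab X Y) x = D E (D X Y) x - \<theta> x (D X Y x) *\<^sub>R E x - \<theta> x (E x) *\<^sub>R D X Y x
      - E x (\<lambda>y. \<theta> y (Y y)) *\<^sub>R X x - \<theta> x (Y x) *\<^sub>R nab E X x
      - E x (\<lambda>y. \<theta> y (X y)) *\<^sub>R Y x - \<theta> x (X x) *\<^sub>R D E Y x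
      + (\<theta> x (X x) * \<theta> x (Y x)) *\<^sub>R E x + (\<theta> x (X x) * \<theta> x (E x)) *\<^sub>R Y x"
    by (rule second[OF E X EY[OF x] _ EDXY]) (rule XY)
  have XE: "nab X (nab E Y) x = D X (D E Y) x - \<theta> x (D E Y x) *\<^sub>R X x - \<theta> x (X x) *\<^sub>R D E Y x
      - X x (\<lambda>y. \<theta> y (Y y)) *\<^sub>R E x - \<theta> x (Y x) *\<^sub>R nab X E x
      - X x (\<lambda>y. \<theta> y (E y)) *\<^sub>R Y x - \<theta> x (E x) *\<^sub>R D X Y x
      + (\<theta> x (E x) * \<theta> x (Y x)) *\<^sub>R X x + (\<theta> x (E x) * \<theta> x (X x)) *\<^sub>R Y x"
    by (rule second[OF X E XY[OF x] _ XDEY]) (rule EY)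
  show ?thesis
    unfolding curvature_def EX XE br curvature_defect_def form_derivative_def ext_deriv_def
    by (simp only: scaleR_diff_right scaleR_diff_left scaleR_add_left scaleR_add_right mult.commute
        diff_conv_add_uminus minus_add_distrib minus_minus scaleR_minus_left scaleR_minus_right
        ac_simps) simp
qed

lemma D_preserves:
  "vector_field_on A W X \<Longrightarrow> vector_field_on A W Y \<Longrightarrow> (\<And>y. y \<in> W \<Longrightarrow> Y y \<in> T1 y) \<Longrightarrow> x \<in> W \<Longrightarrow> D X Y x \<in> T1 x"
  "vector_field_on A W X \<Longrightarrow> vector_field_on A W Y \<Longrightarrow> (\<And>y. y \<in> W \<Longrightarrow> Y y \<in> T2 y) \<Longrightarrow> x \<in> W \<Longrightarrow> D X Y x \<in> T2 x"
  by (rule preserves(1)[unfolded preserves_def, rule_format]; simp)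
    (rule preserves(2)[unfolded preserves_def, rule_format]; simp)

lemma subspace_T: "subspace (T1 x)" "subspace (T2 x)"
  by (rule distribution_subspace[OF distributions(1)], rule distribution_subspace[OF distributions(2)])

lemma bracket_T1:
  assumes X: "vector_field_on A W X" "\<And>y. y \<in> W \<Longrightarrow> X y \<in> T1 y"
    and Y: "vector_field_on A W Y" "\<And>y. y \<in> W \<Longrightarrow> Y y \<in> T1 y" and x: "x \<in> W"
  shows "lie_bracket A X Y x \<in> T1 x"
  using subspace_diff[OF subspace_T(1) D_preserves(1)[OF X(1) Y x] D_preserves(1)[OF Y(1) X x]]
    adapted.torsion_free[OF X(1) Y(1) x] by simp

lemma curvature_T2:
  assumes X: "vector_field_on A W X" and Y: "vector_field_on A W Y"
    and Z: "vector_field_on A W Z" "\<And>y. y \<in> W \<Longrightarrow> Z y \<in> T2 y" and x: "x \<in> W"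
  shows "curvature A D X Y Z x \<in> T2 x"
proof -
  have "D P (D Q Z) x \<in> T2 x" if "vector_field_on A W P" "vector_field_on A W Q" for P Q
    by (rule D_preserves(2)[OF that(1) adapted.conn_field[OF that(2) Z(1)] _ x])
      (rule D_preserves(2)[OF that(2) Z])
  moreover have "D (lie_bracket A X Y) Z x \<in> T2 x"
    by (rule D_preserves(2)[OF adapted.lie_bracket_field[OF X Y] Z x])
  ultimately show ?thesis
    unfolding curvature_def using X Y by (intro subspace_diff[OF subspace_T(2)])
qed

text \<open>In the Bianchi identity for \<open>X\<close>, \<open>Y\<close>, \<open>V\<close> the two terms other than \<open>R(X, Y)V\<close> differentiate
  sections of \<open>T2\<close>. Hence \<open>R(X, Y)V\<close> is orthogonal to \<open>V\<close>, which kills the part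
  \<open>d\<theta>(X, Y) g(V, V)\<close> of \<open>curvature_symmetric_part\<close>.\<close>

lemma lee_ext_deriv_zero_T2:
  assumes X: "vector_field_on A W X" "\<And>y. y \<in> W \<Longrightarrow> X y \<in> T2 y"
    and Y: "vector_field_on A W Y" "\<And>y. y \<in> W \<Longrightarrow> Y y \<in> T2 y"
    and V: "vector_field_on A W V" "\<And>y. y \<in> W \<Longrightarrow> V y \<in> T1 y" "V x \<noteq> 0" and x: "x \<in> W"
  shows "ext_deriv A \<theta> X Y x = 0"
proof -
  have a: "curvature A D Y V X x \<in> T2 x" by (rule curvature_T2[OF Y(1) V(1) X x])
  have b: "curvature A D V X Y x \<in> T2 x" by (rule curvature_T2[OF V(1) X(1) Y x])
  have "curvature A D X Y V x = - (curvature A D Y V X x + curvature A D V X Y x)"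
    using adapted.first_bianchi[OF X(1) Y(1) V(1) x] by (simp only: eq_neg_iff_add_eq_0 add.assoc)
  also have "\<dots> \<in> T2 x" by (intro subspace_neg[OF subspace_T(2)] subspace_add[OF subspace_T(2)] a b)
  finally have "g x (curvature A D X Y V x) (V x) = 0" by (rule orthogonal'[OF V(2)[OF x]])
  moreover have "g x (V x) (V x) > 0" by (rule metric_pos[OF vector_field_on_tangent[OF V(1) x] V(3)])
  ultimately show ?thesis using adapted.curvature_symmetric_part[OF X(1) Y(1) V(1) x] by simp
qed

lemma curvature_defect_expansion:
  assumes frame: "orthogonal_frame T W I E" and x: "x \<in> W"
    and X: "vector_field_on A W X" "\<And>y. y \<in> W \<Longrightarrow> X y \<in> T y" and Y: "vector_field_on A W Y"
  shows "curvature_defect D \<theta> X Y x = (\<Sum>i\<in>I. coordinate (E i) x (X x) * curvature_defect D \<theta> (E i) Y x)"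
proof -
  note cv = one_form_covector[OF lee]
  note t = vector_field_on_tangent[OF _ x]
  have "curvature_defect D \<theta> X Y x = (\<Sum>i\<in>I. coordinate (E i) x (X x) *\<^sub>R curvature_defect D \<theta> (E i) Y x)"
  proof (rule tensorial_expansion[OF frame x X])
    fix X X' assume f: "vector_field_on A W X" "vector_field_on A W X'"
    show "curvature_defect D \<theta> (\<lambda>y. X y + X' y) Y x = curvature_defect D \<theta> X Y x + curvature_defect D \<theta> X' Y x"
      using covector_add[OF cv t[OF f(1)] t[OF f(2)]]
        covector_add[OF cv t[OF adapted.conn_field[OF f(1) Y]] t[OF adapted.conn_field[OF f(2) Y]]]
      by (simp only: curvature_defect_def form_derivative_def adapted.conn_add_left[OF f Y x] plus_fun_apply)
        (simp add: algebra_simps)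
  next
    fix f X assume f: "smooth_function_on A W f" "vector_field_on A W X"
    show "curvature_defect D \<theta> (\<lambda>y. f y *\<^sub>R X y) Y x = f x *\<^sub>R curvature_defect D \<theta> X Y x"
      using covector_scale[OF cv t[OF f(2)]] covector_scale[OF cv t[OF adapted.conn_field[OF f(2) Y]]]
      by (simp add: curvature_defect_def form_derivative_def adapted.conn_scale_left[OF f Y x] scaleR_fun_def[of _ "X x"]
          algebra_simps)
  next
    fix X X' assume f: "vector_field_on A W X" and eq: "\<And>y. y \<in> W \<Longrightarrow> X y = X' y"
    show "curvature_defect D \<theta> X Y x = curvature_defect D \<theta> X' Y x"
      using eq[OF x] adapted.conn_cong[OF f Y x eq refl] by (simp add: curvature_defect_def form_derivative_def)
  qed
  then show ?thesis by simp
qed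

text \<open>In the formula of \<open>curvature_orthogonal\<close> only the two middle terms have components in \<open>T1\<close>. The term
  \<open>h(X, Y)E\<close> contributes the rank and \<open>h(E, Y)X\<close> contributes \<open>h(X, Y)\<close> once, by expanding \<open>X\<close> in the frame.\<close>

lemma curvature_trace_T1:
  assumes frame: "orthogonal_frame T1 W I E" and x: "x \<in> W"
    and X: "vector_field_on A W X" "\<And>y. y \<in> W \<Longrightarrow> X y \<in> T1 y"
    and Y: "vector_field_on A W Y" "\<And>y. y \<in> W \<Longrightarrow> Y y \<in> T2 y"
  shows "(\<Sum>i\<in>I. coordinate (E i) x (curvature A nab (E i) X Y x)) = (real (card I) - 1) * curvature_defect D \<theta> X Y x"
proof -
  note o = frame_orth[OF frame]
  have "coordinate (E i) x (curvature A nab (E i) X Y x) =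
      curvature_defect D \<theta> X Y x - coordinate (E i) x (X x) * curvature_defect D \<theta> (E i) Y x" if i: "i \<in> I" for i
  proof -
    note Ei = orth_field[OF o i] frame_in[OF frame _ i]
    have R: "curvature A nab (E i) X Y x = curvature A D (E i) X Y x + curvature_defect D \<theta> X Y x *\<^sub>R E i x
        - curvature_defect D \<theta> (E i) Y x *\<^sub>R X x - ext_deriv A \<theta> (E i) X x *\<^sub>R Y x"
      by (rule curvature_orthogonal[OF Ei(1) X(1) Y(1) x])
        (intro orthogonal Ei(2) X(2) Y(2) x D_preserves(2)[OF _ Y x] bracket_T1[OF Ei X x] X(1) Ei(1);
          assumption)+
    note cv = metric_covector_left[OF orth_tangent[OF o x i]]
    note t = T_tangent(2)[OF curvature_T2[OF Ei(1) X(1) Y x]] orth_tangent[OF o x i]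
      T_tangent(1)[OF X(2)[OF x]] T_tangent(2)[OF Y(2)[OF x]]
    note sub = subspace_add[OF subspace_tangent_space] subspace_diff[OF subspace_tangent_space]
      subspace_scale[OF subspace_tangent_space]
    have "g x (curvature A nab (E i) X Y x) (E i x) =
        curvature_defect D \<theta> X Y x * g x (E i x) (E i x) - curvature_defect D \<theta> (E i) Y x * g x (X x) (E i x)"
      unfolding R
      by (simp add: covector_diff[OF cv] covector_add[OF cv] covector_scale[OF cv] t sub
          orthogonal'[OF Ei(2)[OF x] Y(2)[OF x]]
          orthogonal'[OF Ei(2)[OF x] curvature_T2[OF Ei(1) X(1) Y x]] del: plus_fun_apply)
    then show ?thesis
      using orth_square_nonzero[OF o x i] by (simp add: coordinate_def diff_divide_distrib)
  qed
  then have "(\<Sum>i\<in>I. coordinate (E i) x (curvature A nab (E i) X Y x)) =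
      (\<Sum>i\<in>I. curvature_defect D \<theta> X Y x) - (\<Sum>i\<in>I. coordinate (E i) x (X x) * curvature_defect D \<theta> (E i) Y x)"
    by (simp add: sum_subtractf)
  also have "\<dots> = (real (card I) - 1) * curvature_defect D \<theta> X Y x"
    using curvature_defect_expansion[OF frame x X Y(1)] by (simp add: algebra_simps)
  finally show ?thesis .
qed

lemma lc_skew:
  assumes "vector_field_on A W X" "vector_field_on A W Y" "vector_field_on A W V" "x \<in> W"
  shows "g x (curvature A nab X Y V x) (V x) = 0"
proof -
  have "ext_deriv A (\<lambda>_ _. 0) X Y x = 0"
    using tangent_const[OF vector_field_on_tangent[OF assms(1,4)]]
      tangent_const[OF vector_field_on_tangent[OF assms(2,4)]] by (simp add: ext_deriv_def)
  then show ?thesis using lc.curvature_symmetric_part[OF assms] by simp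
qed

text \<open>The Bianchi identity for \<open>E\<close>, \<open>X\<close>, \<open>Y\<close> paired with \<open>E\<close>, where \<open>g(R(X, Y)E, E) = 0\<close>.\<close>

lemma curvature_swap_last_two:
  assumes E: "vector_field_on A W E" and X: "vector_field_on A W X" and Y: "vector_field_on A W Y"
    and x: "x \<in> W"
  shows "g x (curvature A nab E X Y x) (E x) = g x (curvature A nab E Y X x) (E x)"
proof -
  note t = vector_field_on_tangent[OF _ x]
  note cv = metric_covector_left[OF t[OF E]]
  have r: "curvature A nab P Q R x \<in> tangent_space A x"
    if "vector_field_on A W P" "vector_field_on A W Q" "vector_field_on A W R" for P Q R
    by (rule t[OF lc.curvature_field[OF that]])
  have "g x (curvature A nab E X Y x + curvature A nab X Y E x + curvature A nab Y E X x) (E x) = 0"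
    unfolding lc.first_bianchi[OF E X Y x] by (rule covector_zero[OF cv])
  moreover have "g x (curvature A nab E X Y x + curvature A nab X Y E x + curvature A nab Y E X x) (E x) =
      g x (curvature A nab E X Y x) (E x) + g x (curvature A nab X Y E x) (E x) + g x (curvature A nab Y E X x) (E x)"
    by (simp only: covector_add[OF cv] r E X Y subspace_add[OF subspace_tangent_space])
  moreover have "g x (curvature A nab Y E X x) (E x) = - g x (curvature A nab E Y X x) (E x)"
    unfolding lc.curvature_swap[OF Y E X x] by (rule covector_minus[OF cv r[OF E Y X]])
  ultimately show ?thesis using lc_skew[OF X Y E x] by simp
qed

text \<open>With \<open>h\<close> the curvature defect, the Ricci hypothesis reads \<open>(p - 1) h(X, Y) + (q - 1) h(Y, X) = 0\<close>.
  Eliminating \<open>h(Y, X) = h(X, Y) - d\<theta>(X, Y)\<close> solves it for \<open>h(X, Y)\<close>.\<close>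

lemma form_derivative_mixed:
  assumes X: "vector_field_on A W X" "\<And>y. y \<in> W \<Longrightarrow> X y \<in> T1 y"
    and Y: "vector_field_on A W Y" "\<And>y. y \<in> W \<Longrightarrow> Y y \<in> T2 y"
    and f1: "orthogonal_frame T1 W {..<p} E1" and f2: "orthogonal_frame T2 W {..<q} E2"
    and x: "x \<in> W" and pq: "p \<ge> 2" "q \<ge> 2"
    and ricci: "ricci A nab x (X x) (Y x) = 0"
  shows "form_derivative D \<theta> X Y x =
    (real q - 1) / (real (p + q) - 2) * ext_deriv A \<theta> X Y x - \<theta> x (X x) * \<theta> x (Y x)"
proof -
  interpret sw: conformal_product A g nab D q p T2 T1 \<theta> by (rule swapped_factors)
  note frame = orthogonal_frame_Plus[OF f1 f2 splitting]
  interpret rc: riemannian_connection A g nab ..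

  \<comment> \<open>the trace splits into the contributions of the two factors\<close>
  have "0 = (\<Sum>i\<in>{..<p} <+> {..<q}. coordinate (case_sum E1 E2 i) x (curvature A nab (case_sum E1 E2 i) X Y x))"
    using rc.ricci_eq_sum[OF frame x X(1) Y(1)] ricci by simp
  also have "\<dots> = (\<Sum>i<p. coordinate (E1 i) x (curvature A nab (E1 i) X Y x))
      + (\<Sum>j<q. coordinate (E2 j) x (curvature A nab (E2 j) X Y x))"
    by (simp add: sum.Plus)
  also have "(\<Sum>j<q. coordinate (E2 j) x (curvature A nab (E2 j) X Y x)) =
      (\<Sum>j<q. coordinate (E2 j) x (curvature A nab (E2 j) Y X x))"
    using curvature_swap_last_two[OF orth_field[OF frame_orth[OF f2]] X(1) Y(1) x]
    by (simp add: coordinate_def)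
  also have "\<dots> = (real q - 1) * curvature_defect D \<theta> Y X x"
    using sw.curvature_trace_T1[OF f2 x Y X] by simp
  also have "(\<Sum>i<p. coordinate (E1 i) x (curvature A nab (E1 i) X Y x)) = (real p - 1) * curvature_defect D \<theta> X Y x"
    using curvature_trace_T1[OF f1 x X Y] by simp
  finally have "(real p - 1) * curvature_defect D \<theta> X Y x + (real q - 1) * curvature_defect D \<theta> Y X x = 0" by simp
  moreover have "curvature_defect D \<theta> Y X x = curvature_defect D \<theta> X Y x - ext_deriv A \<theta> X Y x"
    using adapted.ext_deriv_eq_form_derivative[OF X(1) Y(1) x] by (simp add: curvature_defect_def)
  ultimately have "(real (p + q) - 2) * curvature_defect D \<theta> X Y x = (real q - 1) * ext_deriv A \<theta> X Y x"
    by (simp add: algebra_simps)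
  moreover have "real (p + q) - 2 \<noteq> 0" using pq by simp
  ultimately have "curvature_defect D \<theta> X Y x = (real q - 1) / (real (p + q) - 2) * ext_deriv A \<theta> X Y x"
    by (simp add: field_simps)
  then show ?thesis by (simp add: curvature_defect_def)
qed

lemma form_derivative_add:
  assumes X: "vector_field_on A W X" and Y: "vector_field_on A W Y" and Z: "vector_field_on A W Z"
    and x: "x \<in> W"
  shows "form_derivative D \<theta> (\<lambda>y. X y + Y y) Z x = form_derivative D \<theta> X Z x + form_derivative D \<theta> Y Z x"
    and "form_derivative D \<theta> Z (\<lambda>y. X y + Y y) x = form_derivative D \<theta> Z X x + form_derivative D \<theta> Z Y x"
proof -
  note cv = one_form_covector[OF lee]
  note t = vector_field_on_tangent
  show "form_derivative D \<theta> (\<lambda>y. X y + Y y) Z x = form_derivative D \<theta> X Z x + form_derivative D \<theta> Y Z x"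
    unfolding form_derivative_def adapted.conn_add_left[OF X Y Z x]
      covector_add[OF cv t[OF adapted.conn_field[OF X Z] x] t[OF adapted.conn_field[OF Y Z] x]]
    by simp
  have "Z x (\<lambda>y. \<theta> y (X y + Y y)) = Z x (\<lambda>y. \<theta> y (X y) + \<theta> y (Y y))"
    by (rule tangent_cong[OF t[OF Z x] vector_field_on_open[OF X] x covector_add[OF cv t[OF X] t[OF Y]]])
  also have "\<dots> = Z x (\<lambda>y. \<theta> y (X y)) + Z x (\<lambda>y. \<theta> y (Y y))"
    by (rule tangent_add[OF t[OF Z x] smooth_near_I[OF one_form_smooth[OF lee X] x]
          smooth_near_I[OF one_form_smooth[OF lee Y] x]])
  finally show "form_derivative D \<theta> Z (\<lambda>y. X y + Y y) x = form_derivative D \<theta> Z X x + form_derivative D \<theta> Z Y x"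
    unfolding form_derivative_def adapted.conn_add_right[OF Z X Y x]
      covector_add[OF cv t[OF adapted.conn_field[OF Z X] x] t[OF adapted.conn_field[OF Z Y] x]]
    by simp
qed

lemma form_derivative_cong:
  assumes X: "vector_field_on A W X" and Y: "vector_field_on A W Y" and x: "x \<in> W"
    and eq: "\<And>y. y \<in> W \<Longrightarrow> X y = X' y" "\<And>y. y \<in> W \<Longrightarrow> Y y = Y' y"
  shows "form_derivative D \<theta> X Y x = form_derivative D \<theta> X' Y' x"
proof -
  have "X x (\<lambda>y. \<theta> y (Y y)) = X x (\<lambda>y. \<theta> y (Y' y))"
    by (rule tangent_cong[OF vector_field_on_tangent[OF X x] vector_field_on_open[OF X] x]) (simp add: eq(2))
  then show ?thesis
    using adapted.conn_cong[OF X Y x eq] eq(1)[OF x] by (simp add: form_derivative_def)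
qed

text \<open>The decomposition along \<open>T1\<close> and \<open>T2\<close> is smooth because it is given by coordinates in the frames.\<close>

lemma split_field:
  assumes X: "vector_field_on A V X"
    and f1: "orthogonal_frame T1 V {..<p} E1" and f2: "orthogonal_frame T2 V {..<q} E2"
  obtains X1 X2 where "vector_field_on A V X1" "vector_field_on A V X2"
    "\<And>y. y \<in> V \<Longrightarrow> X1 y \<in> T1 y" "\<And>y. y \<in> V \<Longrightarrow> X2 y \<in> T2 y" "\<And>y. y \<in> V \<Longrightarrow> X y = X1 y + X2 y"
proof (rule that)
  let ?P1 = "\<lambda>y. projection {..<p} E1 y (X y)" and ?P2 = "\<lambda>y. projection {..<q} E2 y (X y)"
  show "vector_field_on A V ?P1" by (rule projection_field[OF frame_orth[OF f1] X order_refl])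
  show "vector_field_on A V ?P2" by (rule projection_field[OF frame_orth[OF f2] X order_refl])
  fix y assume y: "y \<in> V"
  show "?P1 y \<in> T1 y" unfolding frame_span[OF f1 y] by (rule projection_in_span)
  show "?P2 y \<in> T2 y" unfolding frame_span[OF f2 y] by (rule projection_in_span)
  have "X y = (\<Sum>i\<in>{..<p} <+> {..<q}. coordinate (case_sum E1 E2 i) y (X y) *\<^sub>R case_sum E1 E2 i y)"
    by (rule frame_expansion[OF orthogonal_frame_Plus[OF f1 f2 splitting] y vector_field_on_tangent[OF X y]])
  also have "\<dots> = ?P1 y + ?P2 y"
    by (simp only: projection_def sum.Plus[OF finite_lessThan finite_lessThan] sum.case comp_def)
  finally show "X y = ?P1 y + ?P2 y" .
qed

lemma form_components_eq:
  assumes comps: "form_components A T1 T2 \<theta> \<theta>1 \<theta>2" and u: "u \<in> T1 y" and v: "v \<in> T2 y"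
  shows "\<theta>1 y (u + v) = \<theta> y u" and "\<theta>2 y (u + v) = \<theta> y v"
proof -
  note comp = comps[unfolded form_components_def, THEN spec, of y]
  note t = T_tangent(1)[OF u] T_tangent(2)[OF v]
  have c1: "covector A y (\<theta>1 y)" and c2: "covector A y (\<theta>2 y)"
    by (rule comp[THEN conjunct1], rule comp[THEN conjunct2, THEN conjunct1])
  have sum: "\<theta> y w = \<theta>1 y w + \<theta>2 y w" if "w \<in> tangent_space A y" for w
    by (rule comp[THEN conjunct2, THEN conjunct2, THEN conjunct1, rule_format, OF that])
  have z1: "\<theta>1 y v = 0"
    by (rule comp[THEN conjunct2, THEN conjunct2, THEN conjunct2, THEN conjunct1, rule_format, OF v])
  have z2: "\<theta>2 y u = 0"
    by (rule comp[THEN conjunct2, THEN conjunct2, THEN conjunct2, THEN conjunct2, rule_format, OF u])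
  show "\<theta>1 y (u + v) = \<theta> y u" "\<theta>2 y (u + v) = \<theta> y v"
    unfolding covector_add[OF c1 t] covector_add[OF c2 t] sum[OF t(1)] sum[OF t(2)] z1 z2 by simp_all
qed

text \<open>On a field \<open>\<theta>2\<close> takes the value of \<open>\<theta>\<close> on its \<open>T2\<close>-part. As \<open>D\<close> preserves the splitting, the
  \<open>T2\<close>-part of \<open>[X, Y] = D\<^sub>X Y - D\<^sub>Y X\<close> is \<open>D\<^sub>X Y2 - D\<^sub>Y X2\<close>. This also shows that \<open>\<theta>2\<close> is smooth on
  smooth fields, which the second identity uses to differentiate \<open>\<theta>1 = \<theta> - \<theta>2\<close>.\<close>

lemma ext_deriv_component:
  assumes comps: "form_components A T1 T2 \<theta> \<theta>1 \<theta>2" and V: "open V"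
    and X: "vector_field_on A V X" "vector_field_on A V X1" "vector_field_on A V X2"
      "\<And>y. y \<in> V \<Longrightarrow> X1 y \<in> T1 y" "\<And>y. y \<in> V \<Longrightarrow> X2 y \<in> T2 y" "\<And>y. y \<in> V \<Longrightarrow> X y = X1 y + X2 y"
    and Y: "vector_field_on A V Y" "vector_field_on A V Y1" "vector_field_on A V Y2"
      "\<And>y. y \<in> V \<Longrightarrow> Y1 y \<in> T1 y" "\<And>y. y \<in> V \<Longrightarrow> Y2 y \<in> T2 y" "\<And>y. y \<in> V \<Longrightarrow> Y y = Y1 y + Y2 y"
    and x: "x \<in> V"
  shows "ext_deriv A \<theta>2 X Y x = form_derivative D \<theta> X Y2 x - form_derivative D \<theta> Y X2 x"
    and "ext_deriv A \<theta>1 X Y x = ext_deriv A \<theta> X Y x - ext_deriv A \<theta>2 X Y x"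
proof -
  note comp = comps[unfolded form_components_def, THEN spec]
  have c2: "covector A y (\<theta>2 y)" for y
    by (rule comp[THEN conjunct2, THEN conjunct1])
  have sum: "\<theta> y v = \<theta>1 y v + \<theta>2 y v" if "v \<in> tangent_space A y" for y v
    by (rule comp[THEN conjunct2, THEN conjunct2, THEN conjunct1, rule_format, OF that])
  note \<theta>2_eq = form_components_eq(2)[OF comps]
  have \<theta>2X: "\<theta>2 y (X y) = \<theta> y (X2 y)" and \<theta>2Y: "\<theta>2 y (Y y) = \<theta> y (Y2 y)" if "y \<in> V" for y
    unfolding X(6)[OF that] Y(6)[OF that]
    by (rule \<theta>2_eq[OF X(4)[OF that] X(5)[OF that]], rule \<theta>2_eq[OF Y(4)[OF that] Y(5)[OF that]])
  have \<theta>2D: "\<theta>2 x (D P Q x) = \<theta> x (D P Q2 x)"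
    if "vector_field_on A V P" "vector_field_on A V Q" "vector_field_on A V Q1" "vector_field_on A V Q2"
      "\<And>y. y \<in> V \<Longrightarrow> Q1 y \<in> T1 y" "\<And>y. y \<in> V \<Longrightarrow> Q2 y \<in> T2 y" "\<And>y. y \<in> V \<Longrightarrow> Q y = Q1 y + Q2 y"
    for P Q Q1 Q2
  proof -
    have "D P Q x = D P (\<lambda>y. Q1 y + Q2 y) x"
      by (rule adapted.conn_cong[OF that(1,2) x refl that(7)])
    also have "\<dots> = D P Q1 x + D P Q2 x" by (rule adapted.conn_add_right[OF that(1,3,4) x])
    finally show ?thesis
      using \<theta>2_eq[OF D_preserves(1)[OF that(1,3,5) x] D_preserves(2)[OF that(1,4,6) x]] by simp
  qed
  note t = vector_field_on_tangent
  have DXY: "D X Y x \<in> tangent_space A x" and DYX: "D Y X x \<in> tangent_space A x"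
    by (rule t[OF adapted.conn_field[OF X(1) Y(1)] x], rule t[OF adapted.conn_field[OF Y(1) X(1)] x])
  have XY2: "X x (\<lambda>y. \<theta>2 y (Y y)) = X x (\<lambda>y. \<theta> y (Y2 y))"
    by (rule tangent_cong[OF t[OF X(1) x] V x \<theta>2Y])
  have YX2: "Y x (\<lambda>y. \<theta>2 y (X y)) = Y x (\<lambda>y. \<theta> y (X2 y))"
    by (rule tangent_cong[OF t[OF Y(1) x] V x \<theta>2X])
  have "\<theta>2 x (lie_bracket A X Y x) = \<theta> x (D X Y2 x) - \<theta> x (D Y X2 x)"
    using covector_diff[OF c2 DXY DYX] \<theta>2D[OF X(1) Y] \<theta>2D[OF Y(1) X] adapted.torsion_free[OF X(1) Y(1) x]
    by simp
  with XY2 YX2 show "ext_deriv A \<theta>2 X Y x = form_derivative D \<theta> X Y2 x - form_derivative D \<theta> Y X2 x"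
    by (simp add: ext_deriv_def form_derivative_def)
  have \<theta>1: "\<theta>1 y v = \<theta> y v - \<theta>2 y v" if "v \<in> tangent_space A y" for y v
    using sum[OF that] by simp
  have d: "P x (\<lambda>y. \<theta>1 y (Q y)) = P x (\<lambda>y. \<theta> y (Q y)) - P x (\<lambda>y. \<theta>2 y (Q y))"
    if P: "vector_field_on A V P" and Q: "vector_field_on A V Q" "vector_field_on A V Q2"
      and eq: "\<And>y. y \<in> V \<Longrightarrow> \<theta>2 y (Q y) = \<theta> y (Q2 y)" for P Q Q2
  proof -
    have "smooth_near A x (\<lambda>y. \<theta> y (Q2 y))" by (rule smooth_near_I[OF one_form_smooth[OF lee Q(2)] x])
    then have s: "smooth_near A x (\<lambda>y. \<theta>2 y (Q y))"
      by (rule smooth_near_cong[OF V x, rotated]) (simp add: eq)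
    have "P x (\<lambda>y. \<theta>1 y (Q y)) = P x (\<lambda>y. \<theta> y (Q y) - \<theta>2 y (Q y))"
      by (rule tangent_cong[OF t[OF P x] V x \<theta>1[OF t[OF Q(1)]]])
    also have "\<dots> = P x (\<lambda>y. \<theta> y (Q y)) - P x (\<lambda>y. \<theta>2 y (Q y))"
      by (rule tangent_diff[OF t[OF P x] smooth_near_I[OF one_form_smooth[OF lee Q(1)] x] s])
    finally show ?thesis .
  qed
  show "ext_deriv A \<theta>1 X Y x = ext_deriv A \<theta> X Y x - ext_deriv A \<theta>2 X Y x"
    using d[OF X(1) Y(1,3) \<theta>2Y] d[OF Y(1) X(1,3) \<theta>2X]
      \<theta>1[OF t[OF adapted.lie_bracket_field[OF X(1) Y(1)] x]]
    by (simp add: ext_deriv_def)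
qed

end

section \<open>Differentials of the components of the Lee form\<close>

theorem proposition3p2:
  fixes A :: "('m::{t2_space, second_countable_topology}, 'e::euclidean_space) chart set"
    and g :: "'m metric"
    and nab D :: "'m conn"
    and T1 T2 :: "'m \<Rightarrow> 'm tvec set"
    and \<theta> \<theta>1 \<theta>2 :: "'m form1"
    and p q n :: nat
  assumes "smooth_atlas A" and "n = DIM('e)"
    and "riemannian_metric A g" and "levi_civita A g nab"
    and "conformal_product_structure A g nab p q T1 T2 \<theta> D"
    and "form_components A T1 T2 \<theta> \<theta>1 \<theta>2"
    and "p \<ge> 2" and "q \<ge> 2" and "n = p + q"
    and "\<And>x v w. v \<in> T1 x \<Longrightarrow> w \<in> T2 x \<Longrightarrow> ricci A nab x v w = 0"
  shows "\<forall>W X Y. vector_field_on A W X \<and> vector_field_on A W Y \<longrightarrow>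
    (\<forall>x\<in>W.
      ext_deriv A \<theta>1 X Y x =
        (real p - 1) / (real n - 2) * ext_deriv A \<theta> X Y x + wedge \<theta>1 \<theta>2 X Y x \<and>
      ext_deriv A \<theta>2 X Y x =
        (real q - 1) / (real n - 2) * ext_deriv A \<theta> X Y x - wedge \<theta>1 \<theta>2 X Y x)"
proof (intro allI impI ballI)
  fix W X Y x assume XY: "vector_field_on A W X \<and> vector_field_on A W Y" and xW: "x \<in> W"
  interpret conformal_product A g nab D p q T1 T2 \<theta>
    by unfold_locales (fact assms)+
  interpret sw: conformal_product A g nab D q p T2 T1 \<theta> by (rule swapped_factors)
  have "open W" using XY vector_field_on_open by blast
  then obtain V E1 E2 where V: "x \<in> V" "V \<subseteq> W" "open V"
    and f1: "orthogonal_frame T1 V {..<p} E1" and f2: "orthogonal_frame T2 V {..<q} E2"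
    using tangent_frame_near[OF _ xW] by metis
  note x = V(1)
  have X: "vector_field_on A V X" and Y: "vector_field_on A V Y"
    using vector_field_on_subset[OF _ V(3,2)] XY by blast+
  obtain X1 X2 where X12: "vector_field_on A V X1" "vector_field_on A V X2"
    "\<And>y. y \<in> V \<Longrightarrow> X1 y \<in> T1 y" "\<And>y. y \<in> V \<Longrightarrow> X2 y \<in> T2 y" "\<And>y. y \<in> V \<Longrightarrow> X y = X1 y + X2 y"
    using split_field[OF X f1 f2] by metis
  obtain Y1 Y2 where Y12: "vector_field_on A V Y1" "vector_field_on A V Y2"
    "\<And>y. y \<in> V \<Longrightarrow> Y1 y \<in> T1 y" "\<And>y. y \<in> V \<Longrightarrow> Y2 y \<in> T2 y" "\<And>y. y \<in> V \<Longrightarrow> Y y = Y1 y + Y2 y"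
    using split_field[OF Y f1 f2] by metis
  let ?F = "ext_deriv A \<theta>" and ?d = "form_derivative D \<theta>"
  let ?c = "(real q - 1) / (real n - 2)"
  have F: "?F P Q x = ?d P Q x - ?d Q P x" if "vector_field_on A V P" "vector_field_on A V Q" for P Q
    by (rule adapted.ext_deriv_eq_form_derivative[OF that x])
  \<comment> \<open>the first fields of the frames supply a nonzero vector in the complementary factor\<close>
  have F22: "?F X2 Y2 x = 0"
  proof (rule lee_ext_deriv_zero_T2[OF X12(2,4) Y12(2,4) _ _ _ x])
    show "vector_field_on A V (E1 0)" "\<And>y. y \<in> V \<Longrightarrow> E1 0 y \<in> T1 y" "E1 0 x \<noteq> 0"
      using orth_field[OF frame_orth[OF f1]] frame_in[OF f1] orth_nonzero[OF frame_orth[OF f1] x] \<open>p \<ge> 2\<close>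
      by simp_all
  qed
  have F11: "?F X1 Y1 x = 0"
  proof (rule sw.lee_ext_deriv_zero_T2[OF X12(1,3) Y12(1,3) _ _ _ x])
    show "vector_field_on A V (E2 0)" "\<And>y. y \<in> V \<Longrightarrow> E2 0 y \<in> T2 y" "E2 0 x \<noteq> 0"
      using orth_field[OF frame_orth[OF f2]] frame_in[OF f2] orth_nonzero[OF frame_orth[OF f2] x] \<open>q \<ge> 2\<close>
      by simp_all
  qed
  have mixed: "?d P Q x = ?c * ?F P Q x - \<theta> x (P x) * \<theta> x (Q x)"
    if "vector_field_on A V P" "\<And>y. y \<in> V \<Longrightarrow> P y \<in> T1 y" "vector_field_on A V Q" "\<And>y. y \<in> V \<Longrightarrow> Q y \<in> T2 y"
    for P Q
    unfolding \<open>n = p + q\<close>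
    by (rule form_derivative_mixed[OF that f1 f2 x assms(7,8) assms(10)[OF that(2)[OF x] that(4)[OF x]]])
  have split: "?d X Q x = ?d X1 Q x + ?d X2 Q x" "?d Q X x = ?d Q X1 x + ?d Q X2 x"
    "?d Y Q x = ?d Y1 Q x + ?d Y2 Q x" "?d Q Y x = ?d Q Y1 x + ?d Q Y2 x"
    if Q: "vector_field_on A V Q" for Q
    using form_derivative_cong[OF X Q x X12(5) refl] form_derivative_cong[OF Q X x refl X12(5)]
      form_derivative_cong[OF Y Q x Y12(5) refl] form_derivative_cong[OF Q Y x refl Y12(5)]
      form_derivative_add[OF X12(1,2) Q x] form_derivative_add[OF Y12(1,2) Q x] by simp_all
  have XYF: "?F X Y x = ?F X1 Y2 x - ?F Y1 X2 x"
    using F22 F11 unfolding F[OF X Y] F[OF X12(1) Y12(2)] F[OF Y12(1) X12(2)] F[OF X12(1) Y12(1)]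
      F[OF X12(2) Y12(2)] split(1)[OF Y] split(3)[OF X] split(4)[OF X12(1)] split(4)[OF X12(2)]
      split(2)[OF Y12(1)] split(2)[OF Y12(2)] by simp
  have comp: "ext_deriv A \<theta>2 X Y x = ?d X Y2 x - ?d Y X2 x"
    "ext_deriv A \<theta>1 X Y x = ?F X Y x - ext_deriv A \<theta>2 X Y x"
    by (rule ext_deriv_component[OF assms(6) V(3) X X12 Y Y12 x]; assumption)+
  have wedge: "wedge \<theta>1 \<theta>2 X Y x = \<theta> x (X1 x) * \<theta> x (Y2 x) - \<theta> x (Y1 x) * \<theta> x (X2 x)"
    unfolding wedge_def X12(5)[OF x] Y12(5)[OF x]
      form_components_eq[OF assms(6) X12(3)[OF x] X12(4)[OF x]]
      form_components_eq[OF assms(6) Y12(3)[OF x] Y12(4)[OF x]] ..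
  have "ext_deriv A \<theta>2 X Y x = ?d X1 Y2 x - ?d Y1 X2 x"
    using F22 unfolding comp(1) split(1)[OF Y12(2)] split(3)[OF X12(2)] F[OF X12(2) Y12(2)] by simp
  moreover have "?d X1 Y2 x = ?c * ?F X1 Y2 x - \<theta> x (X1 x) * \<theta> x (Y2 x)"
    by (rule mixed[OF X12(1,3) Y12(2,4)])
  moreover have "?d Y1 X2 x = ?c * ?F Y1 X2 x - \<theta> x (Y1 x) * \<theta> x (X2 x)"
    by (rule mixed[OF Y12(1,3) X12(2,4)])
  ultimately have two: "ext_deriv A \<theta>2 X Y x = ?c * ?F X Y x - wedge \<theta>1 \<theta>2 X Y x"
    unfolding XYF wedge by (simp only: right_diff_distrib)
  have p: "(real p - 1) / (real n - 2) = 1 - ?c"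
    using assms(7-9) by (simp add: field_simps)
  have "ext_deriv A \<theta>1 X Y x = (real p - 1) / (real n - 2) * ?F X Y x + wedge \<theta>1 \<theta>2 X Y x"
    unfolding comp(2) two p by (simp only: left_diff_distrib[of 1 ?c] mult_1_left)
  with two show "ext_deriv A \<theta>1 X Y x = (real p - 1) / (real n - 2) * ext_deriv A \<theta> X Y x + wedge \<theta>1 \<theta>2 X Y x \<and>
      ext_deriv A \<theta>2 X Y x = (real q - 1) / (real n - 2) * ext_deriv A \<theta> X Y x - wedge \<theta>1 \<theta>2 X Y x"
    by (rule conjI[rotated])
qed

end
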